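(* Consider the Bernoulli sampling model on a finite connected graph $G=(V,E)$, $V=[n]$ (described in the context), and let $m_i(t):=\mathbb{E}[\theta\mid\mathcal{K}_i(t)]$ be the posterior mean of agent $i$ at time $t$. Then for every agent $i\in V$, $m_i(t)$ converges as $t\to\infty$ to a random variable $m_i(\infty)$, almost surely and in $L^1$. Furthermore, the limit $m_i(\infty)$ is the same for every agent and equals the mean of the optimal Bayes posterior: almost surely, for every $i\in V$, $$m_i(\infty)=\mathbb{E}[\theta\mid S_1,\dots,S_n].$$
   Context: Bernoulli sampling model. Let $G=(V,E)$ be a finite undirected graph with $V=[n]=\{1,\dots,n\}$, and let $\partial i\subseteq V$ denote the set of neighbors of $i$. The unknown state $\theta$ is uniform on $[0,1]$. Each agent $i\in V$ obtains a private signal $S_i\sim\mathrm{Ber}(\theta)$, and $S_1,\dots,S_n$ are conditionally independent given $\theta$. For $t=1,2,\dots$, the information of agent $i$ at time $t$ is the $\sigma$-algebra $\mathcal{K}_i(t):=\sigma\big(S_i,(X_j(s))_{j\in\partial i,\,1\le s<t}\big)$ (so $\mathcal{K}_i(1)=\sigma(S_i)$), and its posterior is $\nu_i(t):=\mathrm{Law}(\theta\mid\mathcal{K}_i(t))$. At time $t$, each agent $i$ samples $Y_i(t)\sim\nu_i(t)$ and then $X_i(t)\sim\mathrm{Ber}(Y_i(t))$ given $\mathcal{K}_i(t)$, conditionally independently of all other information (in particular, conditionally on $\theta$, all signals and all samples and messages at times $s<t$, the pairs $(Y_i(t),X_i(t))$, $i\in V$, are independent with $Y_i(t)$ of law $\nu_i(t)$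 and $X_i(t)$ given $Y_i(t)$ of law $\mathrm{Ber}(Y_i(t))$). Agent $i$ then communicates only $X_i(t)\in\{0,1\}$ to its neighbors. *)

theory Defs
  imports "HOL-Probability.Probability" "Graph_Theory.Graph_Theory"
begin

section \<open>Conditional laws and conditional independence\<close>

text \<open>The family \<open>\<kappa>\<close> is a regular conditional distribution of \<open>X\<close> given \<open>F\<close>: an
  \<open>F\<close>-measurable random probability measure on \<open>N\<close> which is a version of \<open>P (X \<in> A | F)\<close>
  for each fixed \<open>A\<close>.  It is determined up to null sets only, so it appears as a relation.\<close>

definition has_cond_law ::
  "'a measure \<Rightarrow> 'a measure \<Rightarrow> 'b measure \<Rightarrow> ('a \<Rightarrow> 'b) \<Rightarrow> ('a \<Rightarrow> 'b measure) \<Rightarrow> bool" where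
  "has_cond_law M F N X \<kappa> \<longleftrightarrow>
     subalgebra M F \<and> X \<in> M \<rightarrow>\<^sub>M N \<and> \<kappa> \<in> F \<rightarrow>\<^sub>M prob_algebra N \<and>
     (\<forall>A\<in>sets N. AE \<omega> in M.
        real_cond_exp M F (indicator (X -` A \<inter> space M)) \<omega> = measure (\<kappa> \<omega>) A)"

definition cond_indep_vars ::
  "'a measure \<Rightarrow> 'a measure \<Rightarrow> 'b measure \<Rightarrow> ('i \<Rightarrow> 'a \<Rightarrow> 'b) \<Rightarrow> 'i set \<Rightarrow> bool" where
  "cond_indep_vars M F N X I \<longleftrightarrow>
     subalgebra M F \<and> (\<forall>i\<in>I. X i \<in> M \<rightarrow>\<^sub>M N) \<and>
     (\<forall>J A. J \<subseteq> I \<and> finite J \<and> (\<forall>j\<in>J. A j \<in> sets N) \<longrightarrow>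
        (AE \<omega> in M.
           real_cond_exp M F (indicator {\<omega> \<in> space M. \<forall>j\<in>J. X j \<omega> \<in> A j}) \<omega> =
           (\<Prod>j\<in>J. real_cond_exp M F (indicator (X j -` A j \<inter> space M)) \<omega>)))"

section \<open>The Bernoulli sampling model\<close>

definition events_of :: "'a measure \<Rightarrow> 'b measure \<Rightarrow> ('a \<Rightarrow> 'b) \<Rightarrow> 'a set set" where
  "events_of M N X = sets (vimage_algebra (space M) X N)"

definition nbrs :: "nat pair_pre_digraph \<Rightarrow> nat \<Rightarrow> nat set" where
  "nbrs G i = {j. (i, j) \<in> parcs G}"

text \<open>Bits are Booleans, as in \<^const>\<open>bernoulli_pmf\<close>.  \<open>S i\<close> is the signal of agent \<open>i\<close>;
  \<open>Y i t\<close> and \<open>X i t\<close> are its sample and message at time \<open>t\<close>.  Time starts at 1, and values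
  of \<open>X\<close> and \<open>Y\<close> at time 0 are never used.\<close>

definition info ::
  "'a measure \<Rightarrow> nat pair_pre_digraph \<Rightarrow> (nat \<Rightarrow> 'a \<Rightarrow> bool) \<Rightarrow> (nat \<Rightarrow> nat \<Rightarrow> 'a \<Rightarrow> bool) \<Rightarrow>
   nat \<Rightarrow> nat \<Rightarrow> 'a measure" where
  "info M G S X i t = sigma (space M)
     (events_of M (count_space UNIV) (S i) \<union>
      (\<Union>j\<in>nbrs G i. \<Union>s\<in>{1..<t}. events_of M (count_space UNIV) (X j s)))"

definition all_signals ::
  "'a measure \<Rightarrow> nat pair_pre_digraph \<Rightarrow> (nat \<Rightarrow> 'a \<Rightarrow> bool) \<Rightarrow> 'a measure" where
  "all_signals M G S = sigma (space M) (\<Union>i\<in>pverts G. events_of M (count_space UNIV) (S i))"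

text \<open>\<open>history_events\<close> generates the \<open>\<sigma>\<close>-algebra of the state, all signals, and all samples
  and messages at times \<open>1 \<le> s < t\<close>.\<close>

definition history_events ::
  "'a measure \<Rightarrow> nat pair_pre_digraph \<Rightarrow> ('a \<Rightarrow> real) \<Rightarrow> (nat \<Rightarrow> 'a \<Rightarrow> bool) \<Rightarrow>
   (nat \<Rightarrow> nat \<Rightarrow> 'a \<Rightarrow> real) \<Rightarrow> (nat \<Rightarrow> nat \<Rightarrow> 'a \<Rightarrow> bool) \<Rightarrow> nat \<Rightarrow> 'a set set" where
  "history_events M G \<theta> S Y X t =
     events_of M borel \<theta> \<union>
     (\<Union>j\<in>pverts G. events_of M (count_space UNIV) (S j)) \<union>
     (\<Union>j\<in>pverts G. \<Union>s\<in>{1..<t}.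
        events_of M borel (Y j s) \<union> events_of M (count_space UNIV) (X j s))"

text \<open>\<^locale>\<open>pair_pseudo_graph\<close>: finitely many vertices, symmetric adjacency relation; loops are
  permitted but not required.  In \<open>message\<close>, the conditioning on \<open>Y i t\<close> comes on top of the
  history, so \<open>sample\<close> and \<open>message\<close> together fix the conditional law of the pair
  \<open>(Y i t, X i t)\<close> given the history.\<close>

locale bernoulli_sampling = prob_space M
  for M :: "'a measure" +
  fixes n :: nat
    and G :: "nat pair_pre_digraph"
    and \<theta> :: "'a \<Rightarrow> real"
    and S :: "nat \<Rightarrow> 'a \<Rightarrow> bool"
    and \<nu> :: "nat \<Rightarrow> nat \<Rightarrow> 'a \<Rightarrow> real measure"
    and Y :: "nat \<Rightarrow> nat \<Rightarrow> 'a \<Rightarrow> real"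
    and X :: "nat \<Rightarrow> nat \<Rightarrow> 'a \<Rightarrow> bool"
  assumes graph: "pair_pseudo_graph G"
    and vertices: "pverts G = {1..n}"
    and state_measurable: "\<theta> \<in> borel_measurable M"
    and state: "distr M borel \<theta> = uniform_measure lborel {0..1}"
    and signal: "\<And>i. i \<in> pverts G \<Longrightarrow>
      has_cond_law M (vimage_algebra (space M) \<theta> borel) (count_space UNIV) (S i)
        (\<lambda>\<omega>. measure_pmf (bernoulli_pmf (\<theta> \<omega>)))"
    and signals_indep:
      "cond_indep_vars M (vimage_algebra (space M) \<theta> borel) (count_space UNIV) S (pverts G)"
    and posterior: "\<And>i t. i \<in> pverts G \<Longrightarrow> 1 \<le> t \<Longrightarrow>
      has_cond_law M (info M G S X i t) borel \<theta> (\<nu> i t)"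
    and sample: "\<And>i t. i \<in> pverts G \<Longrightarrow> 1 \<le> t \<Longrightarrow>
      has_cond_law M (sigma (space M) (history_events M G \<theta> S Y X t)) borel (Y i t) (\<nu> i t)"
    and message: "\<And>i t. i \<in> pverts G \<Longrightarrow> 1 \<le> t \<Longrightarrow>
      has_cond_law M
        (sigma (space M) (history_events M G \<theta> S Y X t \<union> events_of M borel (Y i t)))
        (count_space UNIV) (X i t) (\<lambda>\<omega>. measure_pmf (bernoulli_pmf (Y i t \<omega>)))"
    and samples_indep: "\<And>t. 1 \<le> t \<Longrightarrow>
      cond_indep_vars M (sigma (space M) (history_events M G \<theta> S Y X t))
        (borel \<Otimes>\<^sub>M count_space UNIV) (\<lambda>i \<omega>. (Y i t \<omega>, X i t \<omega>)) (pverts G)"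

definition post_mean ::
  "'a measure \<Rightarrow> nat pair_pre_digraph \<Rightarrow> ('a \<Rightarrow> real) \<Rightarrow> (nat \<Rightarrow> 'a \<Rightarrow> bool) \<Rightarrow>
   (nat \<Rightarrow> nat \<Rightarrow> 'a \<Rightarrow> bool) \<Rightarrow> nat \<Rightarrow> nat \<Rightarrow> 'a \<Rightarrow> real" where
  "post_mean M G \<theta> S X i t = real_cond_exp M (info M G S X i t) \<theta>"

end

theory Submission
  imports Defs
begin

text \<open>
  Write \<open>m i t\<close> for the posterior mean of agent \<open>i\<close> and \<open>B\<close> for the optimal estimate
  \<open>E[\<theta> | S 1, \<dots>, S n]\<close>.  The whole argument takes place in \<open>L\<^sup>2\<close>, with the almost sure
  statement recovered at the end.

  \<^emph>\<open>Neighbours agree.\<close>  Since \<open>m i t\<close> is a bounded martingale in \<open>t\<close>, its increments tend to 0 in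
  \<open>L\<^sup>2\<close>.  Let \<open>j\<close> be a neighbour of \<open>i\<close> and \<open>x\<close> the message of \<open>j\<close> at time \<open>t\<close>.  Given the
  past, \<open>x\<close> has mean \<open>m j t\<close>, and \<open>\<theta>\<close> and \<open>m i t\<close> belong to the past, so
  \<open>E[x \<theta>] = E[m j t * \<theta>] = E[(m j t)\<^sup>2]\<close> and \<open>E[x * m i t] = E[m j t * m i t]\<close>.  One step later
  agent \<open>i\<close> knows \<open>x\<close>, so \<open>E[x \<theta>] = E[x * m i (t + 1)]\<close>.  Hence
  \<open>E[(m j t)\<^sup>2] - E[m j t * m i t] = E[x * (m i (t + 1) - m i t)]\<close> tends to 0.  Adding the same
  relation with the roles of \<open>i\<close> and \<open>j\<close> exchanged gives \<open>E[(m i t - m j t)\<^sup>2] \<longlonglongrightarrow> 0\<close>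
  (\<open>neighbours_agree\<close>), and connectedness extends this to all pairs of agents (\<open>agents_agree\<close>).

  \<^emph>\<open>The common value is optimal.\<close>  For the uniform prior, \<open>B = (1 + S 1 + \<dots> + S n) / (n + 2)\<close> is
  affine in the signals (\<open>real_cond_exp_signals\<close>).  Messages are produced from signals by
  randomisation that does not look at the state, so \<open>B\<close> is also the conditional mean of \<open>\<theta>\<close>
  given all signals and all past messages (\<open>real_cond_exp_public\<close>).  Therefore
  \<open>E[(B - m i t) * m i t] = E[(\<theta> - m i t) * m i t] = 0\<close>, and
  \<open>E[(B - m i t)\<^sup>2] = E[(\<theta> - m i t) * B]\<close>.  Expanding \<open>B\<close> leaves the terms
  \<open>E[(\<theta> - m i t) * S k]\<close>, and each equals \<open>E[(m k t - m i t) * S k]\<close> because agent \<open>k\<close> knows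
  its own signal.  These tend to 0 by consensus (\<open>mean_sq_dist_bayes_post\<close>), so \<open>m i t \<longlonglongrightarrow> B\<close> in \<open>L\<^sup>2\<close>.

  \<^emph>\<open>Almost sure convergence.\<close>  By the tower property \<open>m i t\<close> is the conditional mean of \<open>B\<close> given the
  information of agent \<open>i\<close>, so Doob's maximal inequality turns convergence in mean into almost
  sure convergence (\<open>AE_tendsto_real_cond_exp\<close>).
\<close>

section \<open>Generated \<sigma>-algebras\<close>

lemma events_of_iff:
  assumes "f \<in> space M \<rightarrow> space N"
  shows "E \<in> events_of M N f \<longleftrightarrow> (\<exists>A\<in>sets N. E = f -` A \<inter> space M)"
  unfolding events_of_def using assms by (auto simp: sets_vimage_algebra2)

lemma events_of_subset_Pow: "events_of M N f \<subseteq> Pow (space M)"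
  unfolding events_of_def using sets.space_closed[of "vimage_algebra (space M) f N"] by simp

lemma measurable_events_of:
  assumes "f \<in> space M \<rightarrow> space N" "events_of M N f \<subseteq> sets F" "space F = space M"
  shows "f \<in> F \<rightarrow>\<^sub>M N"
proof (rule measurableI)
  fix A assume "A \<in> sets N"
  then show "f -` A \<inter> space F \<in> sets F"
    using assms events_of_iff[OF assms(1)] by (metis subsetD)
qed (use assms in auto)

lemma events_of_subset_sets:
  assumes "f \<in> F \<rightarrow>\<^sub>M N" "space F = space M"
  shows "events_of M N f \<subseteq> sets F"
proof
  have "f \<in> space M \<rightarrow> space N" using assms measurable_space[of f F N] by auto
  moreover fix E assume "E \<in> events_of M N f"
  ultimately obtain A where "A \<in> sets N" "E = f -` A \<inter> space F"
    using assms(2) by (auto simp: events_of_iff)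
  then show "E \<in> sets F" using assms(1) by (simp add: measurable_sets)
qed

lemma subalgebra_sigma:
  assumes "A \<subseteq> sets M"
  shows "subalgebra M (sigma (space M) A)"
proof -
  have "A \<subseteq> Pow (space M)" using assms sets.space_closed[of M] by blast
  then show ?thesis
    using sets.sigma_sets_subset[OF assms] by (simp add: subalgebra_def)
qed

lemma sets_sigma_mono:
  assumes "A \<subseteq> B" "B \<subseteq> Pow \<Omega>"
  shows "sets (sigma \<Omega> A) \<subseteq> sets (sigma \<Omega> B)"
  using assms sigma_sets_mono'[of A B \<Omega>] by (simp add: subset_trans)

text \<open>The parameter of a Bernoulli law is clipped to the unit interval.  The state and the samples
  lie there only almost surely, so the formula is needed for every real parameter.\<close>
lemma pmf_bernoulli_clip: "pmf (bernoulli_pmf p) b = (if b then min 1 (max 0 p) else 1 - min 1 (max 0 p))"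
  by (simp add: bernoulli_pmf.rep_eq)

lemma measure_bernoulli_pmf: "measure (measure_pmf (bernoulli_pmf p)) C = (\<Sum>b\<in>C. pmf (bernoulli_pmf p) b)"
  by (rule measure_measure_pmf_finite) (rule finite)

lemma borel_measurable_bernoulli_pmf [measurable]:
  "(\<lambda>p. measure (measure_pmf (bernoulli_pmf p)) C) \<in> borel_measurable borel"
  unfolding measure_bernoulli_pmf pmf_bernoulli_clip
  by (intro borel_measurable_sum) simp

lemma measure_bernoulli_pmf_True: "0 \<le> p \<Longrightarrow> p \<le> 1 \<Longrightarrow> measure (measure_pmf (bernoulli_pmf p)) {True} = p"
  by (simp add: measure_bernoulli_pmf)

lemma integral_uniform_01:
  fixes g :: "real \<Rightarrow> real"
  assumes [measurable]: "g \<in> borel_measurable borel"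
  shows "(\<integral>x. g x \<partial>uniform_measure lborel {0..1}) = (\<integral>x. g x * indicator {0..1} x \<partial>lborel)"
proof -
  have "uniform_measure lborel {0..1::real} = density lborel (\<lambda>x. ennreal (indicator {0..1} x))"
    unfolding uniform_measure_def by (intro density_cong) (auto split: split_indicator)
  then show ?thesis
    by (simp add: integral_real_density mult.commute)
qed

text \<open>The integrand is, up to the factor \<open>- 1 / (a + b + 2)\<close>, the derivative of
  \<open>x ^ (a + 1) * (1 - x) ^ (b + 1)\<close>, which vanishes at both endpoints.  In other words, the Beta
  distribution with parameters \<open>a + 1\<close>, \<open>b + 1\<close> has mean \<open>(a + 1) / (a + b + 2)\<close>.\<close>
lemma beta_mean_orthogonality:
  fixes a b :: nat
  shows "(\<integral>x. (x - (1 + real a) / (real (a + b) + 2)) * (x ^ a * (1 - x) ^ b) * indicator {0..1} x \<partial>lborel) = 0"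
proof -
  define N where "N = real (a + b) + 2"
  have N: "0 < N" by (simp add: N_def)
  define F where "F x = - (x ^ Suc a * (1 - x) ^ Suc b) / N" for x :: real
  define f where "f x = (x - (1 + real a) / N) * (x ^ a * (1 - x) ^ b)" for x :: real
  have "(F has_real_derivative f x) (at x)" for x
  proof -
    have "(F has_real_derivative
        - ((1 + real a) * x ^ a * (1 - x) ^ Suc b - x ^ Suc a * ((1 + real b) * (1 - x) ^ b)) / N) (at x)"
    proof -
      have "((\<lambda>x. x ^ Suc a) has_real_derivative (1 + real a) * x ^ a) (at x)"
        using DERIV_pow[of "Suc a" x] by simp
      moreover have "((\<lambda>x. (1 - x) ^ Suc b) has_real_derivative (1 + real b) * (1 - x) ^ b * (- 1)) (at x)"
      proof -
        have "((\<lambda>x. (1 - x) ^ Suc b) has_real_derivative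
            real (Suc b) * (1 - x) ^ (Suc b - Suc 0) * (- 1)) (at x)"
          by (rule DERIV_chain2[where f = "\<lambda>y. y ^ Suc b" and g = "\<lambda>x. 1 - x"], rule DERIV_pow)
            (auto intro!: derivative_eq_intros)
        then show ?thesis by simp
      qed
      ultimately have "((\<lambda>x. x ^ Suc a * (1 - x) ^ Suc b) has_real_derivative
          (1 + real a) * x ^ a * (1 - x) ^ Suc b + (1 + real b) * (1 - x) ^ b * (- 1) * x ^ Suc a) (at x)"
        by (rule DERIV_mult)
      from DERIV_cdivide[OF DERIV_minus[OF this], of N] show ?thesis
        unfolding F_def by (rule DERIV_cong) (simp add: algebra_simps)
    qed
    also have "- ((1 + real a) * x ^ a * (1 - x) ^ Suc b - x ^ Suc a * ((1 + real b) * (1 - x) ^ b)) / N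
        = - ((1 + real a) * (1 - x) - x * (1 + real b)) / N * (x ^ a * (1 - x) ^ b)"
      by (simp add: algebra_simps)
    also have "- ((1 + real a) * (1 - x) - x * (1 + real b)) / N = x - (1 + real a) / N"
      using N by (simp add: field_simps) (simp add: N_def algebra_simps)
    finally show ?thesis by (simp add: f_def)
  qed
  then have "(\<integral>x. f x * indicator {0..1} x \<partial>lborel) = F 1 - F 0"
    by (intro integral_FTC_Icc_real) (auto simp: f_def intro!: continuous_intros)
  then show ?thesis by (simp add: f_def F_def N_def)
qed

lemma sets_all_in:
  assumes V: "finite V" and Z: "\<And>j. j \<in> V \<Longrightarrow> Z j \<in> M \<rightarrow>\<^sub>M count_space UNIV"
  shows "{\<omega>\<in>space M. \<forall>j\<in>V. Z j \<omega> \<in> C j} \<in> sets M"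
proof (rule sets.sets_Collect_finite_All[OF _ V])
  fix j assume "j \<in> V"
  then have "Z j -` C j \<inter> space M \<in> sets M" using measurable_sets[OF Z, of j "C j"] by simp
  then show "{\<omega>\<in>space M. Z j \<omega> \<in> C j} \<in> sets M" by (simp add: vimage_def Int_def conj_commute)
qed

context prob_space
begin

section \<open>Almost sure convergence of conditional expectations\<close>

lemma sigma_finite_subalgebraI: "subalgebra M F \<Longrightarrow> sigma_finite_subalgebra M F"
  by (intro finite_measure_subalgebra_is_sigma_finite finite_measure_subalgebra.intro
      finite_measure_axioms finite_measure_subalgebra_axioms.intro)

lemma abs_real_cond_exp_le:
  assumes F: "subalgebra M F" and W: "integrable M W"
  shows "AE x in M. \<bar>real_cond_exp M F W x\<bar> \<le> real_cond_exp M F (\<lambda>x. \<bar>W x\<bar>) x"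
proof -
  interpret sigma_finite_subalgebra M F by (rule sigma_finite_subalgebraI[OF F])
  have "AE x in M. real_cond_exp M F W x \<le> real_cond_exp M F (\<lambda>x. \<bar>W x\<bar>) x"
    by (rule real_cond_exp_mono) (use W in auto)
  moreover have "AE x in M. real_cond_exp M F (\<lambda>x. -1 * W x) x \<le> real_cond_exp M F (\<lambda>x. \<bar>W x\<bar>) x"
    by (rule real_cond_exp_mono) (use W in auto)
  moreover have "AE x in M. real_cond_exp M F (\<lambda>x. -1 * W x) x = -1 * real_cond_exp M F W x"
    by (rule real_cond_exp_cmult) fact
  ultimately show ?thesis
    by eventually_elim auto
qed

text \<open>Doob's maximal inequality for the martingale \<open>E[W | F u]\<close>: split the event according to
  the first time \<open>u\<close> at which the threshold is passed.  That piece lies in \<open>F u\<close>, so on it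
  \<open>\<bar>W\<bar>\<close> integrates to at least \<open>\<epsilon>\<close> times its probability.\<close>
lemma maximal_inequality_real_cond_exp:
  fixes F :: "nat \<Rightarrow> 'a measure"
  assumes F: "\<And>u. subalgebra M (F u)"
    and mono: "\<And>u v. u \<le> v \<Longrightarrow> sets (F u) \<subseteq> sets (F v)"
    and W: "integrable M W" and \<epsilon>: "0 < \<epsilon>"
  shows "\<epsilon> * prob {\<omega>\<in>space M. \<exists>u. \<epsilon> < \<bar>real_cond_exp M (F u) W \<omega>\<bar>} \<le> expectation (\<lambda>\<omega>. \<bar>W \<omega>\<bar>)"
proof -
  define B where "B u = {\<omega>\<in>space M. \<epsilon> < \<bar>real_cond_exp M (F u) W \<omega>\<bar>}" for u
  have space_F: "space (F u) = space M" for u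
    using F[of u] by (simp add: subalgebra_def)
  have B_F: "B u \<in> sets (F u)" for u
    unfolding B_def space_F[symmetric, of u] by measurable
  define A where "A = disjointed B"
  have A_F: "A u \<in> sets (F u)" for u
    unfolding A_def disjointed_def using B_F mono
    by (intro sets.Diff sets.finite_UN) (auto, meson less_imp_le_nat subsetD)
  have A_M [measurable]: "A u \<in> sets M" for u
    using A_F F unfolding subalgebra_def by blast
  have [measurable]: "W \<in> borel_measurable M" using W by auto
  let ?D = "density M (\<lambda>\<omega>. ennreal \<bar>W \<omega>\<bar>)"
  have step: "ennreal \<epsilon> * emeasure M (A u) \<le> emeasure ?D (A u)" for u
  proof -
    interpret sigma_finite_subalgebra M "F u" by (rule sigma_finite_subalgebraI[OF F])
    have int: "integrable M (\<lambda>\<omega>. indicator (A u) \<omega> * \<bar>W \<omega>\<bar>)"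
      using integrable_mult_indicator[OF A_M integrable_abs[OF W]] by simp
    have "\<epsilon> * prob (A u) = (\<integral>\<omega>. indicator (A u) \<omega> * \<epsilon> \<partial>M)" by simp
    also have "\<dots> \<le> (\<integral>\<omega>. indicator (A u) \<omega> * real_cond_exp M (F u) (\<lambda>x. \<bar>W x\<bar>) \<omega> \<partial>M)"
    proof (rule integral_mono_AE)
      show "integrable M (\<lambda>\<omega>. indicator (A u) \<omega> * real_cond_exp M (F u) (\<lambda>x. \<bar>W x\<bar>) \<omega>)"
        by (rule real_cond_exp_intg(1)[OF int]) (use A_F in auto)
      show "AE \<omega> in M. indicator (A u) \<omega> * \<epsilon> \<le> indicator (A u) \<omega> * real_cond_exp M (F u) (\<lambda>x. \<bar>W x\<bar>) \<omega>"
        using abs_real_cond_exp_le[OF F W, of u]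
      proof eventually_elim
        case (elim \<omega>)
        show ?case
        proof (cases "\<omega> \<in> A u")
          case True
          then have "\<omega> \<in> B u" using disjointed_subset[of B u] by (auto simp: A_def)
          then show ?thesis using elim True by (simp add: B_def)
        qed simp
      qed
      show "integrable M (\<lambda>\<omega>. indicator (A u) \<omega> * \<epsilon>)"
        by (intro integrable_mult_left integrable_real_indicator) (auto simp: emeasure_eq_measure)
    qed
    also have "\<dots> = (\<integral>\<omega>. indicator (A u) \<omega> * \<bar>W \<omega>\<bar> \<partial>M)"
      by (rule real_cond_exp_intg(2)[OF int]) (use A_F in auto)
    finally have le: "\<epsilon> * prob (A u) \<le> (\<integral>\<omega>. indicator (A u) \<omega> * \<bar>W \<omega>\<bar> \<partial>M)" .
    have "emeasure ?D (A u) = (\<integral>\<^sup>+\<omega>. ennreal (indicator (A u) \<omega> * \<bar>W \<omega>\<bar>) \<partial>M)"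
      by (subst emeasure_density) (auto intro!: nn_integral_cong split: split_indicator)
    also have "\<dots> = ennreal (\<integral>\<omega>. indicator (A u) \<omega> * \<bar>W \<omega>\<bar> \<partial>M)"
      by (rule nn_integral_eq_integral[OF int]) auto
    finally show ?thesis
      using le \<epsilon> by (simp add: emeasure_eq_measure ennreal_mult'[symmetric] ennreal_leI)
  qed
  have disj: "disjoint_family A" unfolding A_def by (rule disjoint_family_disjointed)
  have UA: "(\<Union>u. A u) = {\<omega>\<in>space M. \<exists>u. \<epsilon> < \<bar>real_cond_exp M (F u) W \<omega>\<bar>}"
    unfolding A_def UN_disjointed_eq by (auto simp: B_def)
  have "ennreal \<epsilon> * emeasure M (\<Union>u. A u) = (\<Sum>u. ennreal \<epsilon> * emeasure M (A u))"
    by (subst suminf_emeasure[symmetric]) (use disj in auto)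
  also have "\<dots> \<le> (\<Sum>u. emeasure ?D (A u))"
    by (intro suminf_le step) auto
  also have "\<dots> = emeasure ?D (\<Union>u. A u)"
    by (rule suminf_emeasure) (use disj in auto)
  also have "\<dots> \<le> emeasure ?D (space ?D)"
    by (rule emeasure_space)
  also have "\<dots> = (\<integral>\<^sup>+\<omega>. ennreal \<bar>W \<omega>\<bar> \<partial>M)"
    by (subst emeasure_density) (auto intro!: nn_integral_cong)
  also have "\<dots> = ennreal (expectation (\<lambda>\<omega>. \<bar>W \<omega>\<bar>))"
    by (rule nn_integral_eq_integral) (use W in auto)
  finally show ?thesis
    unfolding UA using \<epsilon>
    by (simp add: emeasure_eq_measure ennreal_mult'[symmetric])
qed

text \<open>Apply the maximal inequality to \<open>W = Z - E[Z | F s]\<close>: for \<open>u \<ge> s\<close> the variable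
  \<open>E[W | F u]\<close> is the increment of the martingale since time \<open>s\<close>, so late increments are
  uniformly small with high probability.  The limit \<open>Z\<close> itself may fail to be measurable for
  the limiting \<open>\<sigma>\<close>-algebra; convergence in mean is what makes it the limit.\<close>
lemma AE_tendsto_real_cond_exp:
  fixes F :: "nat \<Rightarrow> 'a measure"
  assumes F: "\<And>u. subalgebra M (F u)"
    and mono: "\<And>u v. u \<le> v \<Longrightarrow> sets (F u) \<subseteq> sets (F v)"
    and Z: "integrable M Z"
    and L1: "(\<lambda>t. expectation (\<lambda>\<omega>. \<bar>Z \<omega> - real_cond_exp M (F t) Z \<omega>\<bar>)) \<longlonglongrightarrow> 0"
  shows "AE \<omega> in M. (\<lambda>t. real_cond_exp M (F t) Z \<omega>) \<longlonglongrightarrow> Z \<omega>"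
proof -
  let ?E = "\<lambda>t. real_cond_exp M (F t) Z"
  have [measurable]: "Z \<in> borel_measurable M" using Z by auto
  have int_E: "integrable M (?E t)" for t
    by (rule sigma_finite_subalgebra.real_cond_exp_int(1)[OF sigma_finite_subalgebraI[OF F] Z])
  \<comment> \<open>A deviation by \<open>2 * \<epsilon>\<close> after time \<open>s\<close> needs a martingale increment above \<open>\<epsilon>\<close> or an error
    of at least \<open>\<epsilon>\<close> already at time \<open>s\<close>; each has probability at most the error in mean over \<open>\<epsilon>\<close>.\<close>
  have tail: "\<epsilon> * prob {\<omega>\<in>space M. \<exists>u\<ge>s. 2 * \<epsilon> < \<bar>?E u \<omega> - Z \<omega>\<bar>}
      \<le> 2 * expectation (\<lambda>\<omega>. \<bar>Z \<omega> - ?E s \<omega>\<bar>)" if \<epsilon>: "0 < \<epsilon>" for \<epsilon> s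
  proof -
    define W where "W \<omega> = Z \<omega> - ?E s \<omega>" for \<omega>
    have W: "integrable M W" unfolding W_def using Z int_E by auto
    then have [measurable]: "W \<in> borel_measurable M" by auto
    let ?A = "{\<omega>\<in>space M. \<exists>u. \<epsilon> < \<bar>real_cond_exp M (F (s + u)) W \<omega>\<bar>}"
    let ?B = "{\<omega>\<in>space M. \<epsilon> \<le> \<bar>W \<omega>\<bar>}"
    have eq: "AE \<omega> in M. real_cond_exp M (F (s + u)) W \<omega> = ?E (s + u) \<omega> - ?E s \<omega>" for u
    proof -
      interpret sigma_finite_subalgebra M "F (s + u)" by (rule sigma_finite_subalgebraI[OF F])
      have sub: "subalgebra (F (s + u)) (F s)"
        using F mono[of s "s + u"] by (auto simp: subalgebra_def)
      have "AE \<omega> in M. real_cond_exp M (F (s + u)) W \<omega>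
          = real_cond_exp M (F (s + u)) Z \<omega> - real_cond_exp M (F (s + u)) (?E s) \<omega>"
        unfolding W_def by (rule real_cond_exp_diff[OF Z int_E])
      moreover have "AE \<omega> in M. real_cond_exp M (F (s + u)) (?E s) \<omega> = ?E s \<omega>"
        by (rule real_cond_exp_F_meas[OF int_E measurable_from_subalg[OF sub]]) measurable
      ultimately show ?thesis by eventually_elim simp
    qed
    have eq_all: "AE \<omega> in M. \<forall>u. real_cond_exp M (F (s + u)) W \<omega> = ?E (s + u) \<omega> - ?E s \<omega>"
      by (simp add: AE_all_countable eq)
    have "AE \<omega> in M. \<omega> \<in> {\<omega>\<in>space M. \<exists>u\<ge>s. 2 * \<epsilon> < \<bar>?E u \<omega> - Z \<omega>\<bar>} \<longrightarrow> \<omega> \<in> ?A \<union> ?B"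
      using eq_all
    proof eventually_elim
      case (elim \<omega>)
      show ?case
      proof
        assume "\<omega> \<in> {\<omega>\<in>space M. \<exists>u\<ge>s. 2 * \<epsilon> < \<bar>?E u \<omega> - Z \<omega>\<bar>}"
        then obtain u where \<omega>: "\<omega> \<in> space M" and u: "s \<le> u" "2 * \<epsilon> < \<bar>?E u \<omega> - Z \<omega>\<bar>" by auto
        have "real_cond_exp M (F (s + (u - s))) W \<omega> = ?E (s + (u - s)) \<omega> - ?E s \<omega>"
          using elim by blast
        then have "?E u \<omega> - Z \<omega> = real_cond_exp M (F (s + (u - s))) W \<omega> - W \<omega>"
          using u(1) by (simp add: W_def)
        then have "\<epsilon> < \<bar>real_cond_exp M (F (s + (u - s))) W \<omega>\<bar> \<or> \<epsilon> \<le> \<bar>W \<omega>\<bar>"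
          using u(2) by linarith
        then show "\<omega> \<in> ?A \<union> ?B" using \<omega> by blast
      qed
    qed
    then have "prob {\<omega>\<in>space M. \<exists>u\<ge>s. 2 * \<epsilon> < \<bar>?E u \<omega> - Z \<omega>\<bar>} \<le> prob (?A \<union> ?B)"
      by (rule finite_measure_mono_AE) measurable
    also have "\<dots> \<le> prob ?A + prob ?B"
      by (rule measure_Un_le) measurable
    finally have "\<epsilon> * prob {\<omega>\<in>space M. \<exists>u\<ge>s. 2 * \<epsilon> < \<bar>?E u \<omega> - Z \<omega>\<bar>}
        \<le> \<epsilon> * prob ?A + \<epsilon> * prob ?B"
      unfolding distrib_left[symmetric] using \<epsilon> by (intro mult_left_mono) auto
    moreover have "\<epsilon> * prob ?A \<le> expectation (\<lambda>\<omega>. \<bar>W \<omega>\<bar>)"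
      by (rule maximal_inequality_real_cond_exp[OF F mono W \<epsilon>]) simp
    moreover have "\<epsilon> * prob ?B \<le> expectation (\<lambda>\<omega>. \<bar>W \<omega>\<bar>)"
      using integral_Markov_inequality_measure[of M "\<lambda>\<omega>. \<bar>W \<omega>\<bar>" "{}" \<epsilon>] W \<epsilon>
      by (auto simp: field_simps)
    ultimately show ?thesis by (simp add: W_def)
  qed
  have "AE \<omega> in M. \<exists>s. \<forall>u\<ge>s. \<bar>?E u \<omega> - Z \<omega>\<bar> \<le> 2 * inverse (real (Suc k))" for k
  proof -
    define \<epsilon> where "\<epsilon> = inverse (real (Suc k))"
    have \<epsilon>: "0 < \<epsilon>" by (simp add: \<epsilon>_def)
    let ?N = "{\<omega>\<in>space M. \<forall>s. \<exists>u\<ge>s. 2 * \<epsilon> < \<bar>?E u \<omega> - Z \<omega>\<bar>}"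
    have "\<epsilon> * prob ?N \<le> 0"
    proof (rule LIMSEQ_le_const[OF tendsto_mult_right_zero[OF L1, of 2]], intro exI allI impI)
      fix s :: nat
      have "prob ?N \<le> prob {\<omega>\<in>space M. \<exists>u\<ge>s. 2 * \<epsilon> < \<bar>?E u \<omega> - Z \<omega>\<bar>}"
        by (rule finite_measure_mono) auto
      then show "\<epsilon> * prob ?N \<le> 2 * expectation (\<lambda>\<omega>. \<bar>Z \<omega> - ?E s \<omega>\<bar>)"
        using tail[OF \<epsilon>, of s] \<epsilon> by (smt (verit) mult_left_mono)
    qed
    then have "prob ?N = 0"
      using \<epsilon> measure_nonneg[of M ?N] by (simp add: mult_le_0_iff)
    then have "AE \<omega> in M. \<not> (\<forall>s. \<exists>u\<ge>s. 2 * \<epsilon> < \<bar>?E u \<omega> - Z \<omega>\<bar>)"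
      by (subst AE_iff_measurable[OF _ refl]) (auto simp: emeasure_eq_measure)
    then show ?thesis by (simp add: \<epsilon>_def not_less)
  qed
  then have "AE \<omega> in M. \<forall>k. \<exists>s. \<forall>u\<ge>s. \<bar>?E u \<omega> - Z \<omega>\<bar> \<le> 2 * inverse (real (Suc k))"
    by (simp add: AE_all_countable)
  then show ?thesis
  proof eventually_elim
    case (elim \<omega>)
    show ?case
    proof (rule LIMSEQ_I)
      fix r :: real assume "0 < r"
      then obtain k where k: "inverse (real (Suc k)) < r / 2"
        using reals_Archimedean[of "r / 2"] by auto
      obtain s where "\<forall>u\<ge>s. \<bar>?E u \<omega> - Z \<omega>\<bar> \<le> 2 * inverse (real (Suc k))" using elim by blast
      then show "\<exists>s. \<forall>u\<ge>s. norm (?E u \<omega> - Z \<omega>) < r"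
        using k by (intro exI[of _ s]) force
    qed
  qed
qed

section \<open>Conditional laws and independence\<close>

text \<open>A conditional law is specified through events only; integrals against it follow because the
  law of \<open>X\<close> restricted to any \<open>A\<close> in \<open>F\<close> is the mixture of the kernel \<open>\<kappa>\<close> over \<open>A\<close>.\<close>
lemma has_cond_law_real_cond_exp:
  fixes f :: "'b \<Rightarrow> real"
  assumes law: "has_cond_law M F N X \<kappa>"
    and f [measurable]: "f \<in> borel_measurable N" and f01: "\<And>x. 0 \<le> f x" "\<And>x. f x \<le> 1"
  shows "AE \<omega> in M. real_cond_exp M F (\<lambda>\<omega>. f (X \<omega>)) \<omega> = (\<integral>x. f x \<partial>\<kappa> \<omega>)"
proof -
  have F: "subalgebra M F" and X [measurable]: "X \<in> M \<rightarrow>\<^sub>M N"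
    and \<kappa>: "\<kappa> \<in> F \<rightarrow>\<^sub>M prob_algebra N"
    and cond: "\<And>A. A \<in> sets N \<Longrightarrow> AE \<omega> in M.
        real_cond_exp M F (indicator (X -` A \<inter> space M)) \<omega> = measure (\<kappa> \<omega>) A"
    using law by (auto simp: has_cond_law_def)
  interpret sigma_finite_subalgebra M F by (rule sigma_finite_subalgebraI[OF F])
  have \<kappa>F [measurable]: "\<kappa> \<in> F \<rightarrow>\<^sub>M subprob_algebra N" by (rule measurable_prob_algebraD[OF \<kappa>])
  have \<kappa>M [measurable]: "\<kappa> \<in> M \<rightarrow>\<^sub>M subprob_algebra N" by (rule measurable_from_subalg[OF F \<kappa>F])
  have \<kappa>_space: "space F = space M" using F by (simp add: subalgebra_def)
  have prob_\<kappa>: "prob_space (\<kappa> \<omega>)" and sets_\<kappa>: "sets (\<kappa> \<omega>) = sets N" if "\<omega> \<in> space M" for \<omega>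
    using measurable_space[OF \<kappa>, of \<omega>] that \<kappa>_space by (auto simp: space_prob_algebra)
  have int_\<kappa>: "integrable (\<kappa> \<omega>) f" if "\<omega> \<in> space M" for \<omega>
  proof -
    interpret K: prob_space "\<kappa> \<omega>" by (rule prob_\<kappa>[OF that])
    have "f \<in> borel_measurable (\<kappa> \<omega>)"
      using f sets_\<kappa>[OF that] by (simp cong: measurable_cong_sets)
    then show ?thesis
      by (intro K.integrable_const_bound[where B = 1]) (use f01 in auto)
  qed
  have g01: "0 \<le> (\<integral>x. f x \<partial>\<kappa> \<omega>)" "(\<integral>x. f x \<partial>\<kappa> \<omega>) \<le> 1" if "\<omega> \<in> space M" for \<omega>
  proof -
    interpret K: prob_space "\<kappa> \<omega>" by (rule prob_\<kappa>[OF that])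
    show "0 \<le> (\<integral>x. f x \<partial>\<kappa> \<omega>)" using f01 by simp
    have "(\<integral>x. f x \<partial>\<kappa> \<omega>) \<le> (\<integral>x. 1 \<partial>\<kappa> \<omega>)"
      by (rule integral_mono) (use int_\<kappa>[OF that] f01 in auto)
    then show "(\<integral>x. f x \<partial>\<kappa> \<omega>) \<le> 1" by (simp add: K.prob_space)
  qed
  show ?thesis
  proof (rule real_cond_exp_charact)
    show "integrable M (\<lambda>\<omega>. f (X \<omega>))"
      by (rule integrable_const_bound[where B = 1]) (use f01 in auto)
    show "integrable M (\<lambda>\<omega>. \<integral>x. f x \<partial>\<kappa> \<omega>)"
      by (rule integrable_const_bound[where B = 1]) (use g01 in auto)
    show "(\<lambda>\<omega>. \<integral>x. f x \<partial>\<kappa> \<omega>) \<in> borel_measurable F" by measurable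
  next
    fix A assume A: "A \<in> sets F"
    then have [measurable]: "A \<in> sets M" using F by (auto simp: subalgebra_def)
    let ?D = "density M (indicator A)"
    have space_D: "space ?D \<noteq> {}" using not_empty by simp
    \<comment> \<open>Both sides are integrals of \<open>f\<close> with respect to the law of \<open>X\<close> restricted to the event \<open>A\<close>.\<close>
    have laws: "distr ?D N X = ?D \<bind> \<kappa>"
    proof (rule measure_eqI)
      show "sets (distr ?D N X) = sets (?D \<bind> \<kappa>)"
        using sets_bind[of ?D \<kappa> N] sets_\<kappa> space_D by simp
      fix B assume "B \<in> sets (distr ?D N X)"
      then have [measurable]: "B \<in> sets N" by simp
      have "emeasure (?D \<bind> \<kappa>) B = (\<integral>\<^sup>+\<omega>. emeasure (\<kappa> \<omega>) B \<partial>?D)"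
        by (rule emeasure_bind[OF space_D, where N = N]) auto
      also have "\<dots> = (\<integral>\<^sup>+\<omega>. indicator A \<omega> * emeasure (\<kappa> \<omega>) B \<partial>M)"
        by (rule nn_integral_density) measurable
      also have "\<dots> = (\<integral>\<^sup>+\<omega>. ennreal (indicator A \<omega> * real_cond_exp M F (indicator (X -` B \<inter> space M)) \<omega>) \<partial>M)"
      proof (rule nn_integral_cong_AE)
        show "AE \<omega> in M. indicator A \<omega> * emeasure (\<kappa> \<omega>) B
            = ennreal (indicator A \<omega> * real_cond_exp M F (indicator (X -` B \<inter> space M)) \<omega>)"
          using cond[OF \<open>B \<in> sets N\<close>] AE_space
        proof eventually_elim
          case (elim \<omega>)
          interpret K: prob_space "\<kappa> \<omega>" by (rule prob_\<kappa>[OF elim(2)])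
          show ?case using elim(1) by (auto simp: K.emeasure_eq_measure split: split_indicator)
        qed
      qed
      also have "\<dots> = ennreal (\<integral>\<omega>. indicator A \<omega> * real_cond_exp M F (indicator (X -` B \<inter> space M)) \<omega> \<partial>M)"
      proof (rule nn_integral_eq_integral)
        have "integrable M (\<lambda>\<omega>. indicator A \<omega> * indicator (X -` B \<inter> space M) \<omega> :: real)"
          by (rule integrable_const_bound[where B = 1]) (auto split: split_indicator)
        then show "integrable M (\<lambda>\<omega>. indicator A \<omega> * real_cond_exp M F (indicator (X -` B \<inter> space M)) \<omega>)"
          by (rule real_cond_exp_intg(1)) (use A in auto)
        show "AE \<omega> in M. 0 \<le> indicator A \<omega> * real_cond_exp M F (indicator (X -` B \<inter> space M)) \<omega>"
          using cond[OF \<open>B \<in> sets N\<close>] by eventually_elim auto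
      qed
      also have "(\<integral>\<omega>. indicator A \<omega> * real_cond_exp M F (indicator (X -` B \<inter> space M)) \<omega> \<partial>M)
          = (\<integral>\<omega>. indicator A \<omega> * indicator (X -` B \<inter> space M) \<omega> \<partial>M)"
        by (rule real_cond_exp_intg(2), rule integrable_const_bound[where B = 1])
          (use A in \<open>auto split: split_indicator\<close>)
      also have "\<dots> = measure M (A \<inter> (X -` B \<inter> space M))"
        by (simp add: indicator_inter_arith[symmetric])
      also have "ennreal \<dots> = emeasure (distr ?D N X) B"
        by (simp add: emeasure_distr emeasure_density emeasure_eq_measure[symmetric]
            indicator_inter_arith[symmetric])
      finally show "emeasure (distr ?D N X) B = emeasure (?D \<bind> \<kappa>) B" by simp
    qed
    have "(\<integral>\<^sup>+\<omega>. ennreal (indicator A \<omega> * f (X \<omega>)) \<partial>M) = (\<integral>\<^sup>+x. ennreal (f x) \<partial>distr ?D N X)"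
      by (simp add: nn_integral_distr nn_integral_density ennreal_mult' ennreal_indicator)
    also have "\<dots> = (\<integral>\<^sup>+\<omega>. \<integral>\<^sup>+x. ennreal (f x) \<partial>\<kappa> \<omega> \<partial>?D)"
      unfolding laws by (rule nn_integral_bind[where B = N]) auto
    also have "\<dots> = (\<integral>\<^sup>+\<omega>. indicator A \<omega> * (\<integral>\<^sup>+x. ennreal (f x) \<partial>\<kappa> \<omega>) \<partial>M)"
      by (rule nn_integral_density) measurable
    also have "\<dots> = (\<integral>\<^sup>+\<omega>. ennreal (indicator A \<omega> * (\<integral>x. f x \<partial>\<kappa> \<omega>)) \<partial>M)"
    proof (rule nn_integral_cong)
      fix \<omega> assume "\<omega> \<in> space M"
      then have "(\<integral>\<^sup>+x. ennreal (f x) \<partial>\<kappa> \<omega>) = ennreal (\<integral>x. f x \<partial>\<kappa> \<omega>)"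
        using f01 by (intro nn_integral_eq_integral int_\<kappa>) auto
      then show "indicator A \<omega> * (\<integral>\<^sup>+x. ennreal (f x) \<partial>\<kappa> \<omega>) = ennreal (indicator A \<omega> * (\<integral>x. f x \<partial>\<kappa> \<omega>))"
        by (auto split: split_indicator)
    qed
    finally have nn: "(\<integral>\<^sup>+\<omega>. ennreal (indicator A \<omega> * f (X \<omega>)) \<partial>M)
        = (\<integral>\<^sup>+\<omega>. ennreal (indicator A \<omega> * (\<integral>x. f x \<partial>\<kappa> \<omega>)) \<partial>M)" .
    have "(\<integral>\<omega>. indicator A \<omega> * f (X \<omega>) \<partial>M) = enn2real (\<integral>\<^sup>+\<omega>. ennreal (indicator A \<omega> * f (X \<omega>)) \<partial>M)"
      by (rule integral_eq_nn_integral) (use f01 in auto)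
    also have "\<dots> = (\<integral>\<omega>. indicator A \<omega> * (\<integral>x. f x \<partial>\<kappa> \<omega>) \<partial>M)"
      unfolding nn by (rule integral_eq_nn_integral[symmetric]) (use f01 in auto)
    finally show "(\<integral>\<omega>\<in>A. f (X \<omega>) \<partial>M) = (\<integral>\<omega>\<in>A. (\<integral>x. f x \<partial>\<kappa> \<omega>) \<partial>M)"
      by (simp add: set_lebesgue_integral_def)
  qed
qed

text \<open>An instance of the \<open>\<pi>\<close>-\<open>\<lambda>\<close> argument, shaped for adding one round of finitely many new
  variables \<open>Z j\<close> to the known events \<open>F\<close>: the rectangles form a generator that is stable under
  intersection, and on rectangles conditional independence gives product formulas.\<close>
lemma integral_vanishes_on_generated:
  fixes D :: "'a \<Rightarrow> real" and Z :: "'i \<Rightarrow> 'a \<Rightarrow> 'b"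
  assumes F: "subalgebra M F" and V: "finite V"
    and Z: "\<And>j. j \<in> V \<Longrightarrow> Z j \<in> M \<rightarrow>\<^sub>M count_space UNIV" and D: "integrable M D"
    and rect: "\<And>A C. A \<in> sets F \<Longrightarrow>
      (\<integral>\<omega>. D \<omega> * indicator (A \<inter> {\<omega>\<in>space M. \<forall>j\<in>V. Z j \<omega> \<in> C j}) \<omega> \<partial>M) = 0"
    and A: "A \<in> sets (sigma (space M) (sets F \<union> (\<Union>j\<in>V. events_of M (count_space UNIV) (Z j))))"
  shows "(\<integral>\<omega>. D \<omega> * indicator A \<omega> \<partial>M) = 0"
proof -
  let ?R = "{A \<inter> {\<omega>\<in>space M. \<forall>j\<in>V. Z j \<omega> \<in> C j} |A C. A \<in> sets F}"
  let ?U = "sets F \<union> (\<Union>j\<in>V. events_of M (count_space UNIV) (Z j))"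
  have space_F: "space F = space M" and F_M: "sets F \<subseteq> sets M" using F by (auto simp: subalgebra_def)
  have F_Pow: "sets F \<subseteq> Pow (space M)" using sets.space_closed[of F] space_F by simp
  have R_Pow: "?R \<subseteq> Pow (space M)" by auto
  have U_Pow: "?U \<subseteq> Pow (space M)" by (intro Un_least UN_least F_Pow events_of_subset_Pow)
  have R_M: "?R \<subseteq> sets M"
  proof
    fix E assume "E \<in> ?R"
    then obtain A C where A: "A \<in> sets F" and E: "E = A \<inter> {\<omega>\<in>space M. \<forall>j\<in>V. Z j \<omega> \<in> C j}" by blast
    have "{\<omega>\<in>space M. \<forall>j\<in>V. Z j \<omega> \<in> C j} \<in> sets M"
      by (rule sets_all_in[OF V Z])
    then show "E \<in> sets M" using A E F_M by auto
  qed
  have stable: "Int_stable ?R"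
  proof (rule Int_stableI)
    fix a b assume ab: "a \<in> ?R" "b \<in> ?R"
    obtain A C where A: "A \<in> sets F" "a = A \<inter> {\<omega>\<in>space M. \<forall>j\<in>V. Z j \<omega> \<in> C j}"
      using ab(1) by auto
    obtain A' C' where A': "A' \<in> sets F" "b = A' \<inter> {\<omega>\<in>space M. \<forall>j\<in>V. Z j \<omega> \<in> C' j}"
      using ab(2) by auto
    have "a \<inter> b = (A \<inter> A') \<inter> {\<omega>\<in>space M. \<forall>j\<in>V. Z j \<omega> \<in> C j \<inter> C' j}"
      unfolding A A' by auto
    moreover have "A \<inter> A' \<in> sets F" using A A' by auto
    ultimately show "a \<inter> b \<in> ?R"
      by (intro CollectI exI[of _ "A \<inter> A'"] exI[of _ "\<lambda>j. C j \<inter> C' j"] conjI)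
  qed
  have "?U \<subseteq> ?R"
  proof (intro Un_least UN_least subsetI)
    fix E assume E: "E \<in> sets F"
    then have "E = E \<inter> {\<omega>\<in>space M. \<forall>j\<in>V. Z j \<omega> \<in> UNIV}" using F_Pow by auto
    then show "E \<in> ?R" using E by (intro CollectI exI[of _ E] exI[of _ "\<lambda>_. UNIV"]) auto
  next
    fix j E assume "j \<in> V" "E \<in> events_of M (count_space UNIV) (Z j)"
    then obtain B where "E = Z j -` B \<inter> space M" by (subst (asm) events_of_iff) auto
    then have "E = space M \<inter> {\<omega>\<in>space M. \<forall>i\<in>V. Z i \<omega> \<in> (if i = j then B else UNIV)}"
      using \<open>j \<in> V\<close> by auto
    moreover have "space M \<in> sets F" using sets.top[of F] space_F by simp
    ultimately show "E \<in> ?R" by (intro CollectI exI[of _ "space M"] exI[of _ "\<lambda>i. if i = j then B else UNIV"]) auto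
  qed
  then have "sigma_sets (space M) ?U \<subseteq> sigma_sets (space M) ?R" by (rule sigma_sets_mono')
  then have A: "A \<in> sigma_sets (space M) ?R" using A U_Pow by auto
  have sig_M: "sigma_sets (space M) ?R \<subseteq> sets M" by (rule sets.sigma_sets_subset[OF R_M])
  have D_A: "integrable M (\<lambda>\<omega>. D \<omega> * indicator E \<omega>)" if "E \<in> sets M" for E
    using integrable_mult_indicator[OF that D] by (simp add: mult.commute)
  have total: "(\<integral>\<omega>. D \<omega> \<partial>M) = 0"
  proof -
    have "(\<integral>\<omega>. D \<omega> \<partial>M) = (\<integral>\<omega>. D \<omega> * indicator (space M \<inter> {\<omega>\<in>space M. \<forall>j\<in>V. Z j \<omega> \<in> UNIV}) \<omega> \<partial>M)"
      by (intro Bochner_Integration.integral_cong) auto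
    also have "\<dots> = 0" using rect[of "space M" "\<lambda>_. UNIV"] space_F sets.top[of F] by simp
    finally show ?thesis .
  qed
  show ?thesis
    using stable R_Pow A
  proof (induct rule: sigma_sets_induct_disjoint)
    case (basic E)
    then show ?case using rect by blast
  next
    case empty
    then show ?case by simp
  next
    case (compl E)
    then have E: "E \<in> sets M" using sig_M by blast
    have "(\<integral>\<omega>. D \<omega> * indicator (space M - E) \<omega> \<partial>M) = (\<integral>\<omega>. D \<omega> - D \<omega> * indicator E \<omega> \<partial>M)"
      by (intro Bochner_Integration.integral_cong) (auto split: split_indicator)
    also have "\<dots> = (\<integral>\<omega>. D \<omega> \<partial>M) - (\<integral>\<omega>. D \<omega> * indicator E \<omega> \<partial>M)"
      by (rule Bochner_Integration.integral_diff[OF D D_A[OF E]])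
    finally show ?case using total compl by simp
  next
    case (union E)
    have E: "E i \<in> sets M" for i using union sig_M by blast
    have "set_lebesgue_integral M (\<Union>i. E i) D = (\<Sum>i. set_lebesgue_integral M (E i) D)"
    proof (rule lebesgue_integral_countable_add)
      show "set_integrable M (\<Union>i. E i) D"
        unfolding set_integrable_def by (rule integrable_mult_indicator[OF _ D]) (use E in auto)
    qed (use E union(1) in \<open>auto simp: disjoint_family_on_def\<close>)
    moreover have "set_lebesgue_integral M (E i) D = 0" for i
      using union(3) by (simp add: set_lebesgue_integral_def mult.commute)
    ultimately show ?case by (simp add: set_lebesgue_integral_def mult.commute)
  qed
qed

section \<open>Square means of bounded variables\<close>

definition "unit_bounded f \<longleftrightarrow> f \<in> borel_measurable M \<and> (AE \<omega> in M. \<bar>f \<omega> :: real\<bar> \<le> 1)"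

lemma unit_bounded_measurable: "unit_bounded f \<Longrightarrow> f \<in> borel_measurable M"
  by (simp add: unit_bounded_def)

lemma unit_boundedI: "f \<in> borel_measurable M \<Longrightarrow> (AE \<omega> in M. 0 \<le> f \<omega> \<and> f \<omega> \<le> 1) \<Longrightarrow> unit_bounded f"
  unfolding unit_bounded_def by (safe, eventually_elim) auto

lemma unit_bounded_integrable: "unit_bounded f \<Longrightarrow> integrable M f"
  by (rule integrable_const_bound[where B = 1]) (auto simp: unit_bounded_def)

lemma unit_bounded_mult: "unit_bounded f \<Longrightarrow> unit_bounded g \<Longrightarrow> unit_bounded (\<lambda>\<omega>. f \<omega> * g \<omega>)"
proof -
  assume f: "unit_bounded f" and g: "unit_bounded g"
  have "AE \<omega> in M. \<bar>f \<omega>\<bar> \<le> 1" "AE \<omega> in M. \<bar>g \<omega>\<bar> \<le> 1" using f g by (simp_all add: unit_bounded_def)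
  then have "AE \<omega> in M. \<bar>f \<omega> * g \<omega>\<bar> \<le> 1" by eventually_elim (simp add: abs_mult mult_le_one)
  then show ?thesis using f g borel_measurable_times[of f M g] by (simp add: unit_bounded_def)
qed

lemma unit_bounded_integrable_mult: "unit_bounded f \<Longrightarrow> unit_bounded g \<Longrightarrow> integrable M (\<lambda>\<omega>. f \<omega> * g \<omega>)"
  by (intro unit_bounded_integrable unit_bounded_mult)

definition "inner_L2 f g = expectation (\<lambda>\<omega>. f \<omega> * g \<omega> :: real)"

definition "mean_sq_dist f g = expectation (\<lambda>\<omega>. (f \<omega> - g \<omega> :: real)\<^sup>2)"

lemma inner_L2_commute: "inner_L2 f g = inner_L2 g f"
  by (simp add: inner_L2_def mult.commute)

lemma mean_sq_dist_nonneg: "0 \<le> mean_sq_dist f g"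
  by (simp add: mean_sq_dist_def)

lemma mean_sq_dist_self [simp]: "mean_sq_dist f f = 0"
  by (simp add: mean_sq_dist_def)

lemma
  assumes f: "unit_bounded f" and g: "unit_bounded g"
  shows integrable_sq_diff: "integrable M (\<lambda>\<omega>. (f \<omega> - g \<omega>)\<^sup>2)"
    and mean_sq_dist_expand: "mean_sq_dist f g = inner_L2 f f - 2 * inner_L2 f g + inner_L2 g g"
proof -
  note i = unit_bounded_integrable_mult[OF f f] unit_bounded_integrable_mult[OF f g] unit_bounded_integrable_mult[OF g g]
  have eq: "(f \<omega> - g \<omega>)\<^sup>2 = f \<omega> * f \<omega> - 2 * (f \<omega> * g \<omega>) + g \<omega> * g \<omega>" for \<omega>
    by (simp add: power2_eq_square algebra_simps)
  show "integrable M (\<lambda>\<omega>. (f \<omega> - g \<omega>)\<^sup>2)" unfolding eq using i by simp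
  show "mean_sq_dist f g = inner_L2 f f - 2 * inner_L2 f g + inner_L2 g g"
    unfolding mean_sq_dist_def eq inner_L2_def using i by simp
qed

lemma expectation_abs_diff_le:
  assumes f: "unit_bounded f" and g: "unit_bounded g"
  shows "expectation (\<lambda>\<omega>. \<bar>f \<omega> - g \<omega>\<bar>) \<le> sqrt (mean_sq_dist f g)"
proof -
  have "0 \<le> variance (\<lambda>\<omega>. \<bar>f \<omega> - g \<omega>\<bar>)" by (rule variance_positive)
  also have "\<dots> = mean_sq_dist f g - (expectation (\<lambda>\<omega>. \<bar>f \<omega> - g \<omega>\<bar>))\<^sup>2"
    using unit_bounded_integrable[OF f] unit_bounded_integrable[OF g] integrable_sq_diff[OF f g]
    by (subst variance_eq) (auto simp: mean_sq_dist_def)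
  finally show ?thesis by (intro real_le_rsqrt) simp
qed

lemma inner_L2_diff_le:
  assumes f: "unit_bounded f" and g: "unit_bounded g" and h: "unit_bounded h"
  shows "\<bar>inner_L2 f h - inner_L2 g h\<bar> \<le> sqrt (mean_sq_dist f g)"
proof -
  note i = unit_bounded_integrable_mult[OF f h] unit_bounded_integrable_mult[OF g h]
    unit_bounded_integrable[OF f] unit_bounded_integrable[OF g]
  have "inner_L2 f h - inner_L2 g h = expectation (\<lambda>\<omega>. f \<omega> * h \<omega> - g \<omega> * h \<omega>)"
    unfolding inner_L2_def using i by simp
  also have "\<bar>\<dots>\<bar> \<le> expectation (\<lambda>\<omega>. \<bar>f \<omega> * h \<omega> - g \<omega> * h \<omega>\<bar>)" by (rule integral_abs_bound)
  also have "\<dots> \<le> expectation (\<lambda>\<omega>. \<bar>f \<omega> - g \<omega>\<bar>)"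
  proof (rule integral_mono_AE)
    have "AE \<omega> in M. \<bar>h \<omega>\<bar> \<le> 1" using h by (simp add: unit_bounded_def)
    then show "AE \<omega> in M. \<bar>f \<omega> * h \<omega> - g \<omega> * h \<omega>\<bar> \<le> \<bar>f \<omega> - g \<omega>\<bar>"
      by eventually_elim (simp add: left_diff_distrib[symmetric] abs_mult mult_left_le)
  qed (use i in auto)
  also have "\<dots> \<le> sqrt (mean_sq_dist f g)" by (rule expectation_abs_diff_le[OF f g])
  finally show ?thesis .
qed

lemma mean_sq_dist_triangle:
  assumes f: "unit_bounded f" and g: "unit_bounded g" and h: "unit_bounded h"
  shows "mean_sq_dist f h \<le> 2 * mean_sq_dist f g + 2 * mean_sq_dist g h"
proof -
  have "mean_sq_dist f h \<le> expectation (\<lambda>\<omega>. 2 * (f \<omega> - g \<omega>)\<^sup>2 + 2 * (g \<omega> - h \<omega>)\<^sup>2)"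
    unfolding mean_sq_dist_def
  proof (rule integral_mono)
    fix \<omega>
    have "0 \<le> ((f \<omega> - g \<omega>) - (g \<omega> - h \<omega>))\<^sup>2" by simp
    then show "(f \<omega> - h \<omega>)\<^sup>2 \<le> 2 * (f \<omega> - g \<omega>)\<^sup>2 + 2 * (g \<omega> - h \<omega>)\<^sup>2"
      by (simp add: power2_eq_square algebra_simps)
  qed (use integrable_sq_diff[OF f g] integrable_sq_diff[OF g h] integrable_sq_diff[OF f h] in auto)
  also have "\<dots> = 2 * mean_sq_dist f g + 2 * mean_sq_dist g h"
    unfolding mean_sq_dist_def using integrable_sq_diff[OF f g] integrable_sq_diff[OF g h] by simp
  finally show ?thesis .
qed

text \<open>Conditional expectation as an orthogonal projection.  The version \<open>g\<close> is left open, since each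
  application has its own name for the projected variable.\<close>
lemma inner_L2_real_cond_exp:
  assumes F: "subalgebra M F" and f: "unit_bounded f" and h: "unit_bounded h"
    and h_F: "h \<in> borel_measurable F" and ce: "AE \<omega> in M. real_cond_exp M F f \<omega> = g \<omega>"
    and g: "g \<in> borel_measurable M"
  shows "inner_L2 h f = inner_L2 h g"
proof -
  interpret sigma_finite_subalgebra M F by (rule sigma_finite_subalgebraI[OF F])
  have [measurable]: "h \<in> borel_measurable M" "g \<in> borel_measurable M" using h g by (auto simp: unit_bounded_def)
  have "inner_L2 h f = expectation (\<lambda>\<omega>. h \<omega> * real_cond_exp M F f \<omega>)"
    unfolding inner_L2_def
    by (rule real_cond_exp_intg(2)[symmetric, OF unit_bounded_integrable_mult[OF h f] h_F unit_bounded_measurable[OF f]])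
  also have "\<dots> = inner_L2 h g"
    unfolding inner_L2_def by (rule integral_cong_AE) (use ce in auto)
  finally show ?thesis .
qed

end

context bernoulli_sampling
begin

section \<open>Information in the sampling model\<close>

lemma finite_vertices [simp]: "finite (pverts G)"
  by (simp add: vertices)

lemma nbrs_vertices: "j \<in> nbrs G i \<Longrightarrow> j \<in> pverts G"
proof -
  interpret pair_pseudo_graph G by (rule graph)
  show "j \<in> nbrs G i \<Longrightarrow> j \<in> pverts G" using arc_snd_in_verts[of "(i, j)"] by (auto simp: nbrs_def)
qed

lemma nbrs_sym: "j \<in> nbrs G i \<Longrightarrow> i \<in> nbrs G j"
proof -
  interpret pair_pseudo_graph G by (rule graph)
  show "j \<in> nbrs G i \<Longrightarrow> i \<in> nbrs G j" using arcs_symmetric by (auto simp: nbrs_def)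
qed

definition "history t = sigma (space M) (history_events M G \<theta> S Y X t)"

text \<open>All signals and all messages sent before time \<open>t\<close>: what an observer of the whole network knows,
  without the state and the private samples.\<close>
definition "public t = sigma (space M) ((\<Union>j\<in>pverts G. events_of M (count_space UNIV) (S j)) \<union>
  (\<Union>j\<in>pverts G. \<Union>s\<in>{1..<t}. events_of M (count_space UNIV) (X j s)))"

lemma S_measurable: "i \<in> pverts G \<Longrightarrow> S i \<in> M \<rightarrow>\<^sub>M count_space UNIV"
  using signal[of i] by (simp add: has_cond_law_def)

lemma X_measurable: "i \<in> pverts G \<Longrightarrow> 1 \<le> t \<Longrightarrow> X i t \<in> M \<rightarrow>\<^sub>M count_space UNIV"
  using message[of i t] by (simp add: has_cond_law_def)

lemma Y_measurable: "i \<in> pverts G \<Longrightarrow> 1 \<le> t \<Longrightarrow> Y i t \<in> borel_measurable M"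
  using sample[of i t] by (simp add: has_cond_law_def)

lemma info_generators_Pow: "events_of M (count_space UNIV) (S i) \<union>
      (\<Union>j\<in>nbrs G i. \<Union>s\<in>{1..<t}. events_of M (count_space UNIV) (X j s)) \<subseteq> Pow (space M)"
  by (intro Un_least UN_least events_of_subset_Pow)

lemma public_generators_Pow: "(\<Union>j\<in>pverts G. events_of M (count_space UNIV) (S j)) \<union>
  (\<Union>j\<in>pverts G. \<Union>s\<in>{1..<t}. events_of M (count_space UNIV) (X j s)) \<subseteq> Pow (space M)"
  by (intro Un_least UN_least events_of_subset_Pow)

lemma history_events_Pow: "history_events M G \<theta> S Y X t \<subseteq> Pow (space M)"
  unfolding history_events_def by (intro Un_least UN_least events_of_subset_Pow)

lemma space_info [simp]: "space (info M G S X i t) = space M"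
  by (simp add: info_def space_measure_of_conv)

lemma space_public [simp]: "space (public t) = space M"
  by (simp add: public_def space_measure_of_conv)

lemma space_history [simp]: "space (history t) = space M"
  by (simp add: history_def space_measure_of_conv)

lemma info_mono: "t \<le> t' \<Longrightarrow> sets (info M G S X i t) \<subseteq> sets (info M G S X i t')"
  unfolding info_def by (rule sets_sigma_mono[OF _ info_generators_Pow]) fastforce

lemma info_subset_public: "i \<in> pverts G \<Longrightarrow> sets (info M G S X i t) \<subseteq> sets (public t)"
  unfolding info_def public_def
  by (rule sets_sigma_mono[OF _ public_generators_Pow]) (use nbrs_vertices in blast)

lemma public_subset_history: "sets (public t) \<subseteq> sets (history t)"
  unfolding history_def public_def
  by (rule sets_sigma_mono[OF _ history_events_Pow]) (auto simp: history_events_def)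

lemma all_signals_subset_public: "sets (all_signals M G S) \<subseteq> sets (public t)"
  unfolding all_signals_def public_def
  by (rule sets_sigma_mono[OF _ public_generators_Pow]) blast

lemma subalgebra_history: "subalgebra M (history t)"
  unfolding history_def history_events_def
  by (intro subalgebra_sigma Un_least UN_least events_of_subset_sets)
    (auto intro: state_measurable S_measurable X_measurable Y_measurable)

lemma subalgebra_public: "subalgebra M (public t)"
  using subalgebra_history[of t] public_subset_history[of t] by (auto simp: subalgebra_def)

lemma subalgebra_info: "i \<in> pverts G \<Longrightarrow> subalgebra M (info M G S X i t)"
  using subalgebra_public[of t] info_subset_public[of i t] by (auto simp: subalgebra_def)

lemma subalgebra_public_info: "i \<in> pverts G \<Longrightarrow> subalgebra (public t) (info M G S X i t)"
  using info_subset_public[of i t] by (auto simp: subalgebra_def)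

lemma subalgebra_history_public: "subalgebra (history t) (public t)"
  using public_subset_history[of t] by (auto simp: subalgebra_def)

lemma subalgebra_history_info: "i \<in> pverts G \<Longrightarrow> subalgebra (history t) (info M G S X i t)"
  using info_subset_public[of i t] public_subset_history[of t] by (auto simp: subalgebra_def)

lemma subalgebra_public_signals: "subalgebra (public t) (all_signals M G S)"
  using all_signals_subset_public[of t]
  by (auto simp: subalgebra_def all_signals_def space_measure_of_conv)

lemma subalgebra_signals: "subalgebra M (all_signals M G S)"
  using subalgebra_public[of 1] subalgebra_public_signals[of 1] by (auto simp: subalgebra_def)

lemma generator_measurable:
  assumes "E \<subseteq> Pow (space M)" "events_of M N f \<subseteq> E" "f \<in> space M \<rightarrow> space N"
  shows "f \<in> sigma (space M) E \<rightarrow>\<^sub>M N"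
  by (rule measurable_events_of[OF assms(3)]) (use assms in auto)

lemma state_history_measurable: "\<theta> \<in> borel_measurable (history t)"
  unfolding history_def
  by (rule generator_measurable[OF history_events_Pow]) (auto simp: history_events_def)

lemma S_info_measurable: "S i \<in> info M G S X i t \<rightarrow>\<^sub>M count_space UNIV"
  unfolding info_def by (rule generator_measurable[OF info_generators_Pow]) auto

lemma X_info_measurable:
  "j \<in> nbrs G i \<Longrightarrow> 1 \<le> s \<Longrightarrow> s < t \<Longrightarrow> X j s \<in> info M G S X i t \<rightarrow>\<^sub>M count_space UNIV"
  unfolding info_def by (rule generator_measurable[OF info_generators_Pow]) force+

lemma S_signals_measurable: "i \<in> pverts G \<Longrightarrow> S i \<in> all_signals M G S \<rightarrow>\<^sub>M count_space UNIV"
  unfolding all_signals_def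
  by (rule generator_measurable[OF UN_least[OF events_of_subset_Pow]]) auto

lemma state_01: "AE \<omega> in M. 0 \<le> \<theta> \<omega> \<and> \<theta> \<omega> \<le> 1"
proof -
  have [measurable]: "\<theta> \<in> borel_measurable M" by (rule state_measurable)
  have "AE x in uniform_measure lborel {0..1::real}. 0 \<le> x \<and> x \<le> 1"
    by (rule AE_uniform_measureI) auto
  then have "AE x in distr M borel \<theta>. 0 \<le> x \<and> x \<le> 1" unfolding state .
  then show ?thesis by (subst (asm) AE_distr_iff) auto
qed

lemma integrable_state: "integrable M \<theta>"
  by (rule integrable_const_bound[where B = 1]) (use state_01 state_measurable in auto)

lemma expectation_state:
  fixes g :: "real \<Rightarrow> real"
  assumes g [measurable]: "g \<in> borel_measurable borel"
  shows "expectation (\<lambda>\<omega>. g (\<theta> \<omega>)) = (\<integral>x. g x * indicator {0..1} x \<partial>lborel)"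
  using integral_distr[OF state_measurable g] integral_uniform_01[OF g] by (simp add: state)

text \<open>Laplace's rule of succession.\<close>
definition "bayes \<omega> = (1 + (\<Sum>i\<in>pverts G. of_bool (S i \<omega>))) / (real n + 2)"

lemma bayes_01: "0 \<le> bayes \<omega>" "bayes \<omega> \<le> 1"
proof -
  have *: "(\<Sum>i\<in>pverts G. of_bool (S i \<omega>)) \<le> (\<Sum>i\<in>pverts G. 1::real)" by (rule sum_mono) simp
  show "0 \<le> bayes \<omega>" unfolding bayes_def by (intro divide_nonneg_nonneg add_nonneg_nonneg sum_nonneg) auto
  show "bayes \<omega> \<le> 1" using * unfolding bayes_def by (simp add: vertices)
qed

lemma bayes_signals_measurable: "bayes \<in> borel_measurable (all_signals M G S)"
proof -
  have [measurable]: "(\<lambda>\<omega>. of_bool (S i \<omega>) :: real) \<in> borel_measurable (all_signals M G S)" if "i \<in> pverts G" for i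
    using measurable_compose[OF S_signals_measurable[OF that], of "of_bool :: bool \<Rightarrow> real" borel] by simp
  show ?thesis unfolding bayes_def by measurable
qed

lemma bayes_measurable [measurable]: "bayes \<in> borel_measurable M"
  by (rule measurable_from_subalg[OF subalgebra_signals bayes_signals_measurable])

lemma integrable_bayes: "integrable M bayes"
  by (rule integrable_const_bound[where B = 1]) (use bayes_01 in auto)

text \<open>A pattern \<open>s\<close> of signals with \<open>k\<close> ones has likelihood \<open>\<theta> ^ k * (1 - \<theta>) ^ (n - k)\<close>, and on the
  corresponding event the estimate is the mean of the Beta law whose density is proportional to it.\<close>
lemma bayes_residual_atom:
  "expectation (\<lambda>\<omega>. (\<theta> \<omega> - bayes \<omega>) * indicator {\<omega>\<in>space M. \<forall>i\<in>pverts G. S i \<omega> = s i} \<omega>) = 0"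
proof -
  let ?V = "pverts G" and ?T = "vimage_algebra (space M) \<theta> borel"
  let ?E = "{\<omega>\<in>space M. \<forall>i\<in>?V. S i \<omega> = s i}"
  define k where "k = card {i\<in>?V. s i}"
  define l where "l = card {i\<in>?V. \<not> s i}"
  have kl: "k + l = n"
  proof -
    have "k + l = card ({i\<in>?V. s i} \<union> {i\<in>?V. \<not> s i})"
      unfolding k_def l_def by (rule card_Un_disjoint[symmetric]) auto
    also have "{i\<in>?V. s i} \<union> {i\<in>?V. \<not> s i} = ?V" by auto
    finally show ?thesis by (simp add: vertices)
  qed
  define c where "c = (1 + real k) / (real (k + l) + 2)"
  have bayes_E: "bayes \<omega> = c" if "\<omega> \<in> ?E" for \<omega>
  proof -
    have "(\<Sum>i\<in>?V. of_bool (S i \<omega>) :: real) = (\<Sum>i\<in>?V. of_bool (s i))"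
      using that by (intro sum.cong) auto
    also have "\<dots> = real k" by (simp add: k_def sum_of_bool_eq Int_def)
    finally show ?thesis by (simp add: bayes_def c_def kl)
  qed
  have T: "subalgebra M ?T"
    using state_measurable signals_indep by (simp add: cond_indep_vars_def)
  interpret T: sigma_finite_subalgebra M ?T by (rule sigma_finite_subalgebraI[OF T])
  have \<theta>_T: "\<theta> \<in> borel_measurable ?T" by (rule measurable_vimage_algebra1) auto
  have E [measurable]: "?E \<in> sets M"
    using sets_all_in[where C = "\<lambda>i. {s i}", OF finite_vertices S_measurable] by simp
  have [measurable]: "\<theta> \<in> borel_measurable M" by (rule state_measurable)
  have lik: "AE \<omega> in M. real_cond_exp M ?T (indicator ?E) \<omega> = \<theta> \<omega> ^ k * (1 - \<theta> \<omega>) ^ l"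
  proof -
    have "AE \<omega> in M. real_cond_exp M ?T (indicator {\<omega>\<in>space M. \<forall>i\<in>?V. S i \<omega> \<in> {s i}}) \<omega> =
        (\<Prod>i\<in>?V. real_cond_exp M ?T (indicator (S i -` {s i} \<inter> space M)) \<omega>)"
      using signals_indep unfolding cond_indep_vars_def
      by (elim conjE allE[of _ ?V] allE[of _ "\<lambda>i. {s i}"]) auto
    moreover have "AE \<omega> in M. \<forall>i\<in>?V. real_cond_exp M ?T (indicator (S i -` {s i} \<inter> space M)) \<omega>
        = measure (measure_pmf (bernoulli_pmf (\<theta> \<omega>))) {s i}"
      using signal unfolding has_cond_law_def by (intro AE_finite_allI finite_vertices) auto
    ultimately show ?thesis
      using state_01
    proof eventually_elim
      case (elim \<omega>)
      have "real_cond_exp M ?T (indicator ?E) \<omega> = (\<Prod>i\<in>?V. if s i then \<theta> \<omega> else 1 - \<theta> \<omega>)"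
        using elim by (auto simp: measure_bernoulli_pmf pmf_bernoulli_clip intro!: prod.cong)
      also have "\<dots> = (\<Prod>i\<in>{i\<in>?V. s i}. \<theta> \<omega>) * (\<Prod>i\<in>{i\<in>?V. \<not> s i}. 1 - \<theta> \<omega>)"
        by (subst prod.If_cases) (simp_all add: Int_def)
      finally show ?case by (simp add: k_def l_def)
    qed
  qed
  have "expectation (\<lambda>\<omega>. (\<theta> \<omega> - bayes \<omega>) * indicator ?E \<omega>) = expectation (\<lambda>\<omega>. (\<theta> \<omega> - c) * indicator ?E \<omega>)"
    using bayes_E by (intro Bochner_Integration.integral_cong) (auto split: split_indicator)
  also have "\<dots> = expectation (\<lambda>\<omega>. (\<theta> \<omega> - c) * real_cond_exp M ?T (indicator ?E) \<omega>)"
  proof (rule T.real_cond_exp_intg(2)[symmetric])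
    show "integrable M (\<lambda>\<omega>. (\<theta> \<omega> - c) * indicator ?E \<omega>)"
      using integrable_mult_indicator[OF E, of "\<lambda>\<omega>. \<theta> \<omega> - c"] integrable_state by (simp add: mult.commute)
  qed (use \<theta>_T in auto)
  also have "\<dots> = expectation (\<lambda>\<omega>. (\<theta> \<omega> - c) * (\<theta> \<omega> ^ k * (1 - \<theta> \<omega>) ^ l))"
    by (rule integral_cong_AE) (use lik in auto)
  also have "\<dots> = (\<integral>x. (x - c) * (x ^ k * (1 - x) ^ l) * indicator {0..1} x \<partial>lborel)"
    by (rule expectation_state) measurable
  also have "\<dots> = 0"
    unfolding c_def by (rule beta_mean_orthogonality)
  finally show ?thesis .
qed

text \<open>A rectangle of signal values is a finite disjoint union of patterns.  No events are known
  beforehand, so the \<open>\<pi>\<close>-\<open>\<lambda>\<close> argument starts from the trivial \<open>\<sigma>\<close>-algebra.\<close>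
lemma bayes_residual_signals:
  assumes "A \<in> sets (all_signals M G S)"
  shows "expectation (\<lambda>\<omega>. (\<theta> \<omega> - bayes \<omega>) * indicator A \<omega>) = 0"
proof -
  let ?V = "pverts G" and ?F = "sigma (space M) {}"
  show ?thesis
  proof (rule integral_vanishes_on_generated[where F = ?F and V = ?V and Z = S])
    show "subalgebra M ?F" by (rule subalgebra_sigma) simp
    show "integrable M (\<lambda>\<omega>. \<theta> \<omega> - bayes \<omega>)" using integrable_state integrable_bayes by simp
    have "sets (all_signals M G S) \<subseteq> sets (sigma (space M) (sets ?F \<union> (\<Union>j\<in>?V. events_of M (count_space UNIV) (S j))))"
      unfolding all_signals_def
      by (intro sets_sigma_mono Un_least UN_least events_of_subset_Pow)
        (use sets.space_closed[of ?F] in \<open>auto simp: space_measure_of_conv\<close>)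
    then show "A \<in> sets (sigma (space M) (sets ?F \<union> (\<Union>j\<in>?V. events_of M (count_space UNIV) (S j))))"
      using assms by blast
  next
    fix B C assume B: "B \<in> sets ?F"
    then have B_cases: "B = {} \<or> B = space M"
      by (simp add: sigma_sets_empty_eq)
    let ?R = "{\<omega>\<in>space M. \<forall>i\<in>?V. S i \<omega> \<in> C i}"
    let ?E = "\<lambda>s. {\<omega>\<in>space M. \<forall>i\<in>?V. S i \<omega> = s i}"
    have fin: "finite (PiE ?V C)" by (intro finite_PiE) auto
    have "expectation (\<lambda>\<omega>. (\<theta> \<omega> - bayes \<omega>) * indicator ?R \<omega>)
        = expectation (\<lambda>\<omega>. \<Sum>s\<in>PiE ?V C. (\<theta> \<omega> - bayes \<omega>) * indicator (?E s) \<omega>)"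
    proof (rule Bochner_Integration.integral_cong[OF refl])
      fix \<omega> assume \<omega>: "\<omega> \<in> space M"
      let ?r = "restrict (\<lambda>i. S i \<omega>) ?V"
      have eq: "\<omega> \<in> ?E s \<longleftrightarrow> s = ?r" if "s \<in> PiE ?V C" for s
        using that \<omega> by (auto simp: PiE_iff extensional_def fun_eq_iff)
      have "(\<Sum>s\<in>PiE ?V C. (\<theta> \<omega> - bayes \<omega>) * indicator (?E s) \<omega>)
          = (\<Sum>s\<in>PiE ?V C. if s = ?r then \<theta> \<omega> - bayes \<omega> else 0)"
        by (intro sum.cong refl) (use eq in \<open>auto simp: indicator_def\<close>)
      also have "\<dots> = (\<theta> \<omega> - bayes \<omega>) * indicator ?R \<omega>"
        using fin \<omega> by (auto simp: indicator_def PiE_iff)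
      finally show "(\<theta> \<omega> - bayes \<omega>) * indicator ?R \<omega> = (\<Sum>s\<in>PiE ?V C. (\<theta> \<omega> - bayes \<omega>) * indicator (?E s) \<omega>)"
        by simp
    qed
    also have "\<dots> = (\<Sum>s\<in>PiE ?V C. expectation (\<lambda>\<omega>. (\<theta> \<omega> - bayes \<omega>) * indicator (?E s) \<omega>))"
    proof (rule Bochner_Integration.integral_sum)
      fix s
      have "?E s \<in> sets M"
        using sets_all_in[where C = "\<lambda>i. {s i}", OF finite_vertices S_measurable] by simp
      then show "integrable M (\<lambda>\<omega>. (\<theta> \<omega> - bayes \<omega>) * indicator (?E s) \<omega>)"
        using integrable_mult_indicator[of "?E s" M "\<lambda>\<omega>. \<theta> \<omega> - bayes \<omega>"] integrable_state integrable_bayes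
        by (simp add: mult.commute)
    qed
    also have "\<dots> = 0" by (simp add: bayes_residual_atom)
    finally have "expectation (\<lambda>\<omega>. (\<theta> \<omega> - bayes \<omega>) * indicator ?R \<omega>) = 0" .
    moreover have "space M \<inter> ?R = ?R" by auto
    ultimately show "expectation (\<lambda>\<omega>. (\<theta> \<omega> - bayes \<omega>) * indicator (B \<inter> ?R) \<omega>) = 0"
      using B_cases by auto
  qed (auto intro: S_measurable)
qed

section \<open>Laws of the messages\<close>

lemma state_bernoulli_integrable:
  "integrable M (\<lambda>\<omega>. measure (measure_pmf (bernoulli_pmf (\<theta> \<omega>))) C)"
  by (rule integrable_const_bound[where B = 1])
    (auto intro: measurable_compose[OF state_measurable borel_measurable_bernoulli_pmf])

text \<open>The sample is integrated out: given the history, \<open>Y i t\<close> has law \<open>\<nu> i t\<close>, which is also the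
  conditional law of the state given the agent's own information.  So from the point of view of the
  history, a message behaves like a coin whose bias is a fresh copy of the state drawn
  from the posterior.\<close>
lemma message_law:
  assumes i: "i \<in> pverts G" and t: "1 \<le> t"
  shows "AE \<omega> in M. real_cond_exp M (history t) (indicator (X i t -` C \<inter> space M)) \<omega>
    = real_cond_exp M (info M G S X i t) (\<lambda>\<omega>. measure (measure_pmf (bernoulli_pmf (\<theta> \<omega>))) C) \<omega>"
proof -
  let ?h = "\<lambda>y. measure (measure_pmf (bernoulli_pmf y)) C"
  let ?Q = "indicator (X i t -` C \<inter> space M) :: 'a \<Rightarrow> real"
  let ?H' = "sigma (space M) (history_events M G \<theta> S Y X t \<union> events_of M borel (Y i t))"
  have H': "subalgebra M ?H'"
    and msg: "AE \<omega> in M. real_cond_exp M ?H' ?Q \<omega> = ?h (Y i t \<omega>)"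
    using message[OF i t] by (auto simp: has_cond_law_def)
  have sub: "subalgebra ?H' (history t)"
    using sets_sigma_mono[of "history_events M G \<theta> S Y X t"
        "history_events M G \<theta> S Y X t \<union> events_of M borel (Y i t)" "space M"]
      history_events_Pow[of t] events_of_subset_Pow[of M borel "Y i t"]
    by (auto simp: subalgebra_def history_def space_measure_of_conv)
  interpret sigma_finite_subalgebra M "history t" by (rule sigma_finite_subalgebraI[OF subalgebra_history])
  have [measurable]: "X i t \<in> M \<rightarrow>\<^sub>M count_space UNIV" by (rule X_measurable[OF i t])
  have "X i t -` C \<inter> space M \<in> sets M" by measurable
  then have Q: "integrable M ?Q" by (intro integrable_real_indicator) (auto simp: emeasure_eq_measure)
  have hY: "(\<lambda>\<omega>. ?h (Y i t \<omega>)) \<in> borel_measurable M"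
    by (rule measurable_compose[OF Y_measurable[OF i t] borel_measurable_bernoulli_pmf])
  have "AE \<omega> in M. real_cond_exp M (history t) (real_cond_exp M ?H' ?Q) \<omega> = real_cond_exp M (history t) ?Q \<omega>"
    by (rule real_cond_exp_nested_subalg[OF H' sub Q])
  moreover have "AE \<omega> in M. real_cond_exp M (history t) (real_cond_exp M ?H' ?Q) \<omega>
      = real_cond_exp M (history t) (\<lambda>\<omega>. ?h (Y i t \<omega>)) \<omega>"
    by (rule real_cond_exp_cong[OF msg _ hY]) measurable
  moreover have "AE \<omega> in M. real_cond_exp M (history t) (\<lambda>\<omega>. ?h (Y i t \<omega>)) \<omega> = (\<integral>y. ?h y \<partial>\<nu> i t \<omega>)"
    unfolding history_def by (rule has_cond_law_real_cond_exp[OF sample[OF i t]]) auto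
  moreover have "AE \<omega> in M. real_cond_exp M (info M G S X i t) (\<lambda>\<omega>. ?h (\<theta> \<omega>)) \<omega> = (\<integral>y. ?h y \<partial>\<nu> i t \<omega>)"
    by (rule has_cond_law_real_cond_exp[OF posterior[OF i t]]) auto
  ultimately show ?thesis by eventually_elim simp
qed

abbreviation "post i t \<equiv> post_mean M G \<theta> S X i t"

text \<open>A coin of bias \<open>\<theta>\<close> shows 1 with probability \<open>\<theta>\<close>, because clipping to the unit interval
  almost surely changes nothing; averaging over the posterior leaves its mean.\<close>
lemma message_mean:
  assumes i: "i \<in> pverts G" and t: "1 \<le> t"
  shows "AE \<omega> in M. real_cond_exp M (history t) (\<lambda>\<omega>. of_bool (X i t \<omega>)) \<omega> = post i t \<omega>"
proof -
  interpret H: sigma_finite_subalgebra M "history t"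
    by (rule sigma_finite_subalgebraI[OF subalgebra_history])
  interpret K: sigma_finite_subalgebra M "info M G S X i t"
    by (rule sigma_finite_subalgebraI[OF subalgebra_info[OF i]])
  have [measurable]: "X i t \<in> M \<rightarrow>\<^sub>M count_space UNIV" by (rule X_measurable[OF i t])
  have [measurable]: "X i t -` {True} \<inter> space M \<in> sets M" by measurable
  have "AE \<omega> in M. real_cond_exp M (history t) (indicator (X i t -` {True} \<inter> space M)) \<omega>
      = real_cond_exp M (history t) (\<lambda>\<omega>. of_bool (X i t \<omega>)) \<omega>"
    by (rule H.real_cond_exp_cong) (auto split: split_indicator)
  moreover have "AE \<omega> in M. real_cond_exp M (info M G S X i t)
      (\<lambda>\<omega>. measure (measure_pmf (bernoulli_pmf (\<theta> \<omega>))) {True}) \<omega> = post i t \<omega>"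
    unfolding post_mean_def
    by (rule K.real_cond_exp_cong)
      (use state_01 state_measurable borel_measurable_integrable[OF state_bernoulli_integrable]
        in \<open>auto simp: measure_bernoulli_pmf_True\<close>)
  ultimately show ?thesis using message_law[OF i t, of "{True}"] by eventually_elim simp
qed

lemma messages_law:
  assumes t: "1 \<le> t"
  shows "AE \<omega> in M. real_cond_exp M (history t) (indicator {\<omega>\<in>space M. \<forall>j\<in>pverts G. X j t \<omega> \<in> C j}) \<omega>
    = (\<Prod>j\<in>pverts G. real_cond_exp M (info M G S X j t)
        (\<lambda>\<omega>. measure (measure_pmf (bernoulli_pmf (\<theta> \<omega>))) (C j)) \<omega>)"
proof -
  let ?V = "pverts G" and ?Z = "\<lambda>i \<omega>. (Y i t \<omega>, X i t \<omega>)"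
  have C: "(UNIV :: real set) \<times> C j \<in> sets (borel \<Otimes>\<^sub>M count_space UNIV)" for j
    by (intro pair_measureI) auto
  have joint: "AE \<omega> in M. real_cond_exp M (history t) (indicator {\<omega>\<in>space M. \<forall>j\<in>?V. ?Z j \<omega> \<in> UNIV \<times> C j}) \<omega> =
        (\<Prod>j\<in>?V. real_cond_exp M (history t) (indicator (?Z j -` (UNIV \<times> C j) \<inter> space M)) \<omega>)"
    using samples_indep[OF t] C unfolding cond_indep_vars_def history_def
    by (elim conjE allE[of _ ?V] allE[of _ "\<lambda>j. UNIV \<times> C j"]) auto
  have rect: "{\<omega>\<in>space M. \<forall>j\<in>?V. ?Z j \<omega> \<in> UNIV \<times> C j} = {\<omega>\<in>space M. \<forall>j\<in>?V. X j t \<omega> \<in> C j}" by auto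
  have side: "?Z j -` (UNIV \<times> C j) \<inter> space M = X j t -` C j \<inter> space M" for j by auto
  have marg: "AE \<omega> in M. \<forall>j\<in>?V. real_cond_exp M (history t) (indicator (X j t -` C j \<inter> space M)) \<omega>
      = real_cond_exp M (info M G S X j t) (\<lambda>\<omega>. measure (measure_pmf (bernoulli_pmf (\<theta> \<omega>))) (C j)) \<omega>"
    by (intro AE_finite_allI finite_vertices message_law t)
  show ?thesis
    using joint marg unfolding rect side by eventually_elim simp
qed

text \<open>Messages carry no information on the state beyond the signals.  Inductively, let \<open>B\<close> be an event
  known publicly at time \<open>t\<close>.  The residual \<open>\<theta> - bayes\<close> is known to the history, so the indicator
  of a pattern of new messages may be replaced by its conditional probability; the latter is a product of
  functions of the individual posteriors, hence public, and the residual is orthogonal to it.\<close>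
lemma bayes_residual_public:
  assumes "1 \<le> t" "A \<in> sets (public t)"
  shows "expectation (\<lambda>\<omega>. (\<theta> \<omega> - bayes \<omega>) * indicator A \<omega>) = 0"
  using assms
proof (induction t arbitrary: A rule: dec_induct)
  case base
  have "public 1 = all_signals M G S" by (simp add: public_def all_signals_def)
  then show ?case using base bayes_residual_signals by simp
next
  case (step t)
  let ?V = "pverts G" and ?D = "\<lambda>\<omega>. \<theta> \<omega> - bayes \<omega>"
  have D: "integrable M ?D" using integrable_state integrable_bayes by simp
  have D1: "AE \<omega> in M. \<bar>?D \<omega>\<bar> \<le> 1"
    using state_01 by eventually_elim (use bayes_01 in \<open>smt (verit)\<close>)
  have D_H [measurable]: "?D \<in> borel_measurable (history t)"
    using state_history_measurable measurable_from_subalg[OF subalgebra_history_public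
        measurable_from_subalg[OF subalgebra_public_signals bayes_signals_measurable]] by simp
  show ?case
  proof (rule integral_vanishes_on_generated[where F = "public t" and V = ?V and Z = "\<lambda>j. X j t"])
    show "subalgebra M (public t)" by (rule subalgebra_public)
    have "sets (public (Suc t)) \<subseteq> sets (sigma (space M)
        (sets (public t) \<union> (\<Union>j\<in>?V. events_of M (count_space UNIV) (X j t))))"
    proof -
      let ?U = "sets (public t) \<union> (\<Union>j\<in>?V. events_of M (count_space UNIV) (X j t))"
      have U: "?U \<subseteq> Pow (space M)"
        using sets.space_closed[of "public t"] by (intro Un_least UN_least events_of_subset_Pow) simp
      have old: "E \<subseteq> sets (public t)"
        if "E \<subseteq> (\<Union>j\<in>pverts G. events_of M (count_space UNIV) (S j)) \<union>
          (\<Union>j\<in>pverts G. \<Union>s\<in>{1..<t}. events_of M (count_space UNIV) (X j s))" for E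
        using that public_generators_Pow[of t] unfolding public_def by auto
      have "(\<Union>j\<in>pverts G. events_of M (count_space UNIV) (S j)) \<union>
          (\<Union>j\<in>pverts G. \<Union>s\<in>{1..<Suc t}. events_of M (count_space UNIV) (X j s)) \<subseteq> ?U"
      proof (intro Un_least UN_least)
        fix j assume "j \<in> pverts G"
        then show "events_of M (count_space UNIV) (S j) \<subseteq> ?U"
          using old[of "events_of M (count_space UNIV) (S j)"] by blast
      next
        fix j s assume "j \<in> pverts G" "s \<in> {1..<Suc t}"
        then show "events_of M (count_space UNIV) (X j s) \<subseteq> ?U"
          using old[of "events_of M (count_space UNIV) (X j s)"] by (cases "s = t") fastforce+
      qed
      then show ?thesis unfolding public_def[of "Suc t"] by (rule sets_sigma_mono[OF _ U])
    qed
    then show "A \<in> sets (sigma (space M) (sets (public t) \<union> (\<Union>j\<in>?V. events_of M (count_space UNIV) (X j t))))"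
      using step.prems by blast
  next
    fix B C assume B: "B \<in> sets (public t)"
    interpret H: sigma_finite_subalgebra M "history t"
      by (rule sigma_finite_subalgebraI[OF subalgebra_history])
    interpret P: sigma_finite_subalgebra M "public t"
      by (rule sigma_finite_subalgebraI[OF subalgebra_public])
    have B_H [measurable]: "B \<in> sets (history t)" using B public_subset_history by blast
    have B_M [measurable]: "B \<in> sets M" using B subalgebra_public[of t] by (auto simp: subalgebra_def)
    let ?R = "{\<omega>\<in>space M. \<forall>j\<in>?V. X j t \<omega> \<in> C j}"
    define q where "q j = real_cond_exp M (info M G S X j t)
        (\<lambda>\<omega>. measure (measure_pmf (bernoulli_pmf (\<theta> \<omega>))) (C j))" for j
    have R [measurable]: "?R \<in> sets M"
      using sets_all_in[where C = C and Z = "\<lambda>j. X j t", OF finite_vertices X_measurable] step.hyps by simp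
    have q_P [measurable]: "q j \<in> borel_measurable (public t)" if "j \<in> ?V" for j
      unfolding q_def by (rule measurable_from_subalg[OF subalgebra_public_info[OF that]]) measurable
    have q01: "AE \<omega> in M. \<forall>j\<in>?V. 0 \<le> q j \<omega> \<and> q j \<omega> \<le> 1"
    proof (intro AE_finite_allI finite_vertices)
      fix j assume j: "j \<in> ?V"
      interpret K: sigma_finite_subalgebra M "info M G S X j t"
        by (rule sigma_finite_subalgebraI[OF subalgebra_info[OF j]])
      show "AE \<omega> in M. 0 \<le> q j \<omega> \<and> q j \<omega> \<le> 1"
        unfolding q_def
        by (intro AE_conjI K.real_cond_exp_ge_c K.real_cond_exp_le_c state_bernoulli_integrable AE_I2) auto
    qed
    define p where "p \<omega> = indicator B \<omega> * (\<Prod>j\<in>?V. q j \<omega>)" for \<omega>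
    have p_P [measurable]: "p \<in> borel_measurable (public t)"
      unfolding p_def using B by measurable
    have p_M [measurable]: "p \<in> borel_measurable M"
      by (rule measurable_from_subalg[OF subalgebra_public p_P])
    have p1: "AE \<omega> in M. \<bar>p \<omega>\<bar> \<le> 1"
      using q01
    proof eventually_elim
      case (elim \<omega>)
      then have "0 \<le> (\<Prod>j\<in>?V. q j \<omega>)" "(\<Prod>j\<in>?V. q j \<omega>) \<le> 1" by (auto intro: prod_nonneg prod_le_1)
      then show ?case by (auto simp: p_def split: split_indicator)
    qed
    have [measurable]: "?D \<in> borel_measurable M" using D by auto
    have D_B: "integrable M (\<lambda>\<omega>. (?D \<omega> * indicator B \<omega>) * indicator ?R \<omega>)"
      using integrable_mult_indicator[OF R integrable_mult_indicator[OF B_M D]] by (simp add: mult_ac)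
    have p_D: "integrable M (\<lambda>\<omega>. p \<omega> * ?D \<omega>)"
    proof (rule integrable_const_bound[where B = 1])
      show "AE \<omega> in M. norm (p \<omega> * ?D \<omega>) \<le> 1"
        using p1 D1 by eventually_elim (simp add: abs_mult mult_le_one)
    qed measurable
    have "expectation (\<lambda>\<omega>. ?D \<omega> * indicator (B \<inter> ?R) \<omega>)
        = expectation (\<lambda>\<omega>. (?D \<omega> * indicator B \<omega>) * indicator ?R \<omega>)"
      by (simp add: indicator_inter_arith mult.assoc)
    also have "\<dots> = expectation (\<lambda>\<omega>. (?D \<omega> * indicator B \<omega>) * real_cond_exp M (history t) (indicator ?R) \<omega>)"
      by (rule H.real_cond_exp_intg(2)[symmetric, OF D_B]) measurable
    also have "\<dots> = expectation (\<lambda>\<omega>. p \<omega> * ?D \<omega>)"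
    proof (rule integral_cong_AE)
      show "AE \<omega> in M. (?D \<omega> * indicator B \<omega>) * real_cond_exp M (history t) (indicator ?R) \<omega> = p \<omega> * ?D \<omega>"
        using messages_law[OF step.hyps(1), of C] by eventually_elim (simp add: p_def q_def)
    qed measurable
    also have "\<dots> = expectation (\<lambda>\<omega>. p \<omega> * real_cond_exp M (public t) ?D \<omega>)"
      by (rule P.real_cond_exp_intg(2)[symmetric, OF p_D]) measurable
    also have "\<dots> = expectation (\<lambda>\<omega>. 0)"
    proof (rule integral_cong_AE)
      have "AE \<omega> in M. real_cond_exp M (public t) ?D \<omega> = 0"
        by (rule P.real_cond_exp_charact)
          (use D step.IH in \<open>auto simp: set_lebesgue_integral_def mult.commute\<close>)
      then show "AE \<omega> in M. p \<omega> * real_cond_exp M (public t) ?D \<omega> = 0" by eventually_elim simp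
    qed measurable
    finally show "expectation (\<lambda>\<omega>. ?D \<omega> * indicator (B \<inter> ?R) \<omega>) = 0" by simp
  qed (use D X_measurable step.hyps in auto)
qed

section \<open>Consensus and convergence\<close>

lemma post_info_measurable: "post i t \<in> borel_measurable (info M G S X i t)"
  by (simp add: post_mean_def)

lemma post_public_measurable: "i \<in> pverts G \<Longrightarrow> post i t \<in> borel_measurable (public t)"
  by (rule measurable_from_subalg[OF subalgebra_public_info post_info_measurable])

lemma post_history_measurable: "i \<in> pverts G \<Longrightarrow> post i t \<in> borel_measurable (history t)"
  by (rule measurable_from_subalg[OF subalgebra_history_info post_info_measurable])

lemma unit_bounded_post:
  assumes "i \<in> pverts G"
  shows "unit_bounded (post i t)"
proof (rule unit_boundedI)
  interpret sigma_finite_subalgebra M "info M G S X i t"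
    by (rule sigma_finite_subalgebraI[OF subalgebra_info[OF assms]])
  show "post i t \<in> borel_measurable M" by (simp add: post_mean_def)
  show "AE \<omega> in M. 0 \<le> post i t \<omega> \<and> post i t \<omega> \<le> 1"
    unfolding post_mean_def using state_01
    by (intro AE_conjI real_cond_exp_ge_c real_cond_exp_le_c integrable_state) auto
qed

lemma unit_bounded_state: "unit_bounded \<theta>"
  by (rule unit_boundedI[OF state_measurable state_01])

lemma unit_bounded_bayes: "unit_bounded bayes"
  by (rule unit_boundedI) (auto simp: bayes_01)

lemma unit_bounded_of_bool:
  assumes "b \<in> M \<rightarrow>\<^sub>M count_space UNIV"
  shows "unit_bounded (\<lambda>\<omega>. of_bool (b \<omega>))"
  by (rule unit_boundedI) (use measurable_compose[OF assms, of "of_bool :: bool \<Rightarrow> real" borel] in auto)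

lemma real_cond_exp_public:
  assumes t: "1 \<le> t"
  shows "AE \<omega> in M. real_cond_exp M (public t) \<theta> \<omega> = bayes \<omega>"
proof -
  interpret sigma_finite_subalgebra M "public t" by (rule sigma_finite_subalgebraI[OF subalgebra_public])
  show ?thesis
  proof (rule real_cond_exp_charact[OF _ integrable_state integrable_bayes])
    show "bayes \<in> borel_measurable (public t)"
      by (rule measurable_from_subalg[OF subalgebra_public_signals bayes_signals_measurable])
    fix A assume A: "A \<in> sets (public t)"
    then have A_M: "A \<in> sets M" using subalgebra_public[of t] by (auto simp: subalgebra_def)
    have "expectation (\<lambda>\<omega>. (\<theta> \<omega> - bayes \<omega>) * indicator A \<omega>)
        = expectation (\<lambda>\<omega>. indicator A \<omega> * \<theta> \<omega> - indicator A \<omega> * bayes \<omega>)"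
      by (simp add: algebra_simps)
    also have "\<dots> = expectation (\<lambda>\<omega>. indicator A \<omega> * \<theta> \<omega>) - expectation (\<lambda>\<omega>. indicator A \<omega> * bayes \<omega>)"
      using integrable_mult_indicator[OF A_M integrable_state] integrable_mult_indicator[OF A_M integrable_bayes]
      by (intro Bochner_Integration.integral_diff) auto
    finally show "(\<integral>\<omega>\<in>A. \<theta> \<omega> \<partial>M) = (\<integral>\<omega>\<in>A. bayes \<omega> \<partial>M)"
      using bayes_residual_public[OF t A] by (simp add: set_lebesgue_integral_def)
  qed
qed

lemma real_cond_exp_signals: "AE \<omega> in M. real_cond_exp M (all_signals M G S) \<theta> \<omega> = bayes \<omega>"
  using real_cond_exp_public[of 1] by (simp add: public_def all_signals_def)

lemma real_cond_exp_info_bayes: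
  assumes i: "i \<in> pverts G" and t: "1 \<le> t"
  shows "AE \<omega> in M. real_cond_exp M (info M G S X i t) bayes \<omega> = post i t \<omega>"
proof -
  interpret sigma_finite_subalgebra M "info M G S X i t"
    by (rule sigma_finite_subalgebraI[OF subalgebra_info[OF i]])
  have "AE \<omega> in M. real_cond_exp M (info M G S X i t) (real_cond_exp M (public t) \<theta>) \<omega>
      = real_cond_exp M (info M G S X i t) \<theta> \<omega>"
    by (rule real_cond_exp_nested_subalg[OF subalgebra_public subalgebra_public_info[OF i] integrable_state])
  moreover have "AE \<omega> in M. real_cond_exp M (info M G S X i t) (real_cond_exp M (public t) \<theta>) \<omega>
      = real_cond_exp M (info M G S X i t) bayes \<omega>"
    by (rule real_cond_exp_cong[OF real_cond_exp_public[OF t]]) measurable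
  ultimately show ?thesis unfolding post_mean_def by eventually_elim simp
qed

lemma inner_state_post:
  assumes "i \<in> pverts G" "unit_bounded h" "h \<in> borel_measurable (info M G S X i t)"
  shows "inner_L2 h \<theta> = inner_L2 h (post i t)"
  by (rule inner_L2_real_cond_exp[OF subalgebra_info[OF assms(1)] unit_bounded_state assms(2,3)])
    (auto simp: post_mean_def)

lemma inner_state_bayes:
  assumes "1 \<le> t" "unit_bounded h" "h \<in> borel_measurable (public t)"
  shows "inner_L2 h \<theta> = inner_L2 h bayes"
  by (rule inner_L2_real_cond_exp[OF subalgebra_public unit_bounded_state assms(2,3) real_cond_exp_public[OF assms(1)]]) simp

lemma inner_message_post:
  assumes "i \<in> pverts G" "1 \<le> t" "unit_bounded h" "h \<in> borel_measurable (history t)"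
  shows "inner_L2 h (\<lambda>\<omega>. of_bool (X i t \<omega>)) = inner_L2 h (post i t)"
  by (rule inner_L2_real_cond_exp[OF subalgebra_history unit_bounded_of_bool[OF X_measurable[OF assms(1,2)]]
      assms(3,4) message_mean[OF assms(1,2)]])
    (rule unit_bounded_measurable[OF unit_bounded_post[OF assms(1)]])

text \<open>Pythagoras for the martingale of posterior means.\<close>
lemma mean_sq_dist_post_step:
  assumes i: "i \<in> pverts G"
  shows "mean_sq_dist (post i (Suc t)) (post i t)
    = inner_L2 (post i (Suc t)) (post i (Suc t)) - inner_L2 (post i t) (post i t)"
proof -
  have "post i t \<in> borel_measurable (info M G S X i (Suc t))"
    using post_info_measurable[of i t] info_mono[of t "Suc t" i]
    by (auto simp: measurable_def)
  then have "inner_L2 (post i t) (post i (Suc t)) = inner_L2 (post i t) \<theta>"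
    using inner_state_post[OF i unit_bounded_post[OF i]] by simp
  also have "\<dots> = inner_L2 (post i t) (post i t)"
    by (rule inner_state_post[OF i unit_bounded_post[OF i] post_info_measurable])
  finally show ?thesis
    by (simp add: mean_sq_dist_expand unit_bounded_post[OF i] inner_L2_commute[of "post i (Suc t)" "post i t"])
qed

text \<open>The second moments increase and are bounded by 1, so they converge and their differences vanish.\<close>
lemma mean_sq_dist_post_step_tendsto:
  assumes i: "i \<in> pverts G"
  shows "(\<lambda>t. mean_sq_dist (post i (Suc t)) (post i t)) \<longlonglongrightarrow> 0"
proof -
  define a where "a t = inner_L2 (post i t) (post i t)" for t
  have "incseq a"
  proof (rule incseq_SucI)
    fix t
    show "a t \<le> a (Suc t)"
      using mean_sq_dist_nonneg[of "post i (Suc t)" "post i t"] by (simp add: a_def mean_sq_dist_post_step[OF i])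
  qed
  moreover have "a t \<le> 1" for t
  proof -
    have "a t \<le> expectation (\<lambda>\<omega>. 1)"
      unfolding a_def inner_L2_def
    proof (rule integral_mono_AE)
      show "AE \<omega> in M. post i t \<omega> * post i t \<omega> \<le> 1"
        using unit_bounded_mult[OF unit_bounded_post[OF i] unit_bounded_post[OF i], of t t]
        by (auto simp: unit_bounded_def elim!: eventually_mono)
    qed (use unit_bounded_integrable_mult[OF unit_bounded_post[OF i] unit_bounded_post[OF i]] in auto)
    then show ?thesis by (simp add: prob_space)
  qed
  ultimately obtain L where "a \<longlonglongrightarrow> L" using incseq_convergent by blast
  then have "(\<lambda>t. a (Suc t) - a t) \<longlonglongrightarrow> L - L" by (intro tendsto_diff LIMSEQ_Suc)
  then show ?thesis by (simp add: a_def mean_sq_dist_post_step[OF i])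
qed

text \<open>The heart of the consensus argument: evaluate \<open>E[x \<theta>]\<close> for the message \<open>x\<close> of \<open>j\<close> both through
  what \<open>j\<close> believed when sending it and through what \<open>i\<close> believes after receiving it.  Any
  disagreement between the two agents forces \<open>i\<close> to update.\<close>
lemma neighbour_defect:
  assumes i: "i \<in> pverts G" and j: "j \<in> nbrs G i" and t: "1 \<le> t"
  shows "inner_L2 (post j t) (post j t) - inner_L2 (post j t) (post i t)
    \<le> sqrt (mean_sq_dist (post i (Suc t)) (post i t))"
proof -
  let ?x = "\<lambda>\<omega>. of_bool (X j t \<omega>) :: real"
  have jV: "j \<in> pverts G" by (rule nbrs_vertices[OF j])
  note ub = unit_bounded_post[OF i] unit_bounded_post[OF jV] unit_bounded_state
  have x: "unit_bounded ?x" by (rule unit_bounded_of_bool[OF X_measurable[OF jV t]])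
  have x_info: "?x \<in> borel_measurable (info M G S X i (Suc t))"
    using measurable_compose[OF X_info_measurable[OF j t, of "Suc t"], of "of_bool :: bool \<Rightarrow> real" borel] by simp
  have "inner_L2 (post j t) (post j t) = inner_L2 (post j t) \<theta>"
    by (rule inner_state_post[symmetric, OF jV ub(2) post_info_measurable])
  also have "\<dots> = inner_L2 ?x \<theta>"
    using inner_message_post[OF jV t ub(3) state_history_measurable] by (simp add: inner_L2_commute)
  also have "\<dots> = inner_L2 ?x (post i (Suc t))"
    by (rule inner_state_post[OF i x x_info])
  also have "\<dots> = inner_L2 (post i (Suc t)) ?x" by (rule inner_L2_commute)
  finally have 1: "inner_L2 (post j t) (post j t) = inner_L2 (post i (Suc t)) ?x" .
  have 2: "inner_L2 (post i t) ?x = inner_L2 (post j t) (post i t)"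
    using inner_message_post[OF jV t ub(1) post_history_measurable[OF i]] by (simp add: inner_L2_commute)
  show ?thesis
    using inner_L2_diff_le[OF ub(1) ub(1) x, of "Suc t" t] unfolding 1 2 by linarith
qed

text \<open>The defects of the two directions add up to the mean square distance; this is where the symmetry of
  the adjacency relation enters.\<close>
lemma neighbours_agree:
  assumes i: "i \<in> pverts G" and j: "j \<in> nbrs G i"
  shows "(\<lambda>t. mean_sq_dist (post i t) (post j t)) \<longlonglongrightarrow> 0"
proof (rule tendsto_sandwich[OF _ _ tendsto_const])
  have jV: "j \<in> pverts G" by (rule nbrs_vertices[OF j])
  let ?b = "\<lambda>t. sqrt (mean_sq_dist (post i (Suc t)) (post i t)) + sqrt (mean_sq_dist (post j (Suc t)) (post j t))"
  show "\<forall>\<^sub>F t in sequentially. 0 \<le> mean_sq_dist (post i t) (post j t)" by (simp add: mean_sq_dist_nonneg)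
  show "\<forall>\<^sub>F t in sequentially. mean_sq_dist (post i t) (post j t) \<le> ?b t"
    using eventually_ge_at_top[of 1]
  proof eventually_elim
    case (elim t)
    have "mean_sq_dist (post i t) (post j t)
        = (inner_L2 (post j t) (post j t) - inner_L2 (post j t) (post i t))
        + (inner_L2 (post i t) (post i t) - inner_L2 (post i t) (post j t))"
      by (simp add: mean_sq_dist_expand unit_bounded_post i jV inner_L2_commute[of "post j t" "post i t"])
    then show ?case
      using neighbour_defect[OF i j elim] neighbour_defect[OF jV nbrs_sym[OF j] elim] by linarith
  qed
  have "?b \<longlonglongrightarrow> sqrt 0 + sqrt 0"
    by (intro tendsto_intros mean_sq_dist_post_step_tendsto i jV)
  then show "?b \<longlonglongrightarrow> 0" by simp
qed

lemma agents_agree: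
  assumes conn: "Digraph_Component.connected (with_proj G)" and i: "i \<in> pverts G" and j: "j \<in> pverts G"
  shows "(\<lambda>t. mean_sq_dist (post i t) (post j t)) \<longlonglongrightarrow> 0"
proof -
  interpret pair_pseudo_graph G by (rule graph)
  have "i \<rightarrow>\<^sup>*\<^bsub>with_proj (mk_symmetric G)\<^esub> j"
    using conn i j by (auto simp: connected_def strongly_connected_def)
  then have "(i, j) \<in> (arcs_ends (with_proj (mk_symmetric G)))\<^sup>*"
    by (rule reachable_rtranclI)
  moreover have "arcs_ends (with_proj (mk_symmetric G)) \<subseteq> {(a, b). b \<in> nbrs G a}"
    using arcs_symmetric by (auto simp: nbrs_def parcs_mk_symmetric)
  ultimately have "(i, j) \<in> {(a, b). b \<in> nbrs G a}\<^sup>*" using rtrancl_mono by blast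
  then show ?thesis
  proof (induction rule: rtrancl_induct)
    case base
    then show ?case by simp
  next
    case (step k l)
    then have l: "l \<in> nbrs G k" by simp
    then have kV: "k \<in> pverts G" and lV: "l \<in> pverts G" using nbrs_sym nbrs_vertices by blast+
    have "(\<lambda>t. 2 * mean_sq_dist (post i t) (post k t) + 2 * mean_sq_dist (post k t) (post l t)) \<longlonglongrightarrow> 2 * 0 + 2 * 0"
      by (intro tendsto_intros step.IH neighbours_agree[OF kV l])
    then have lim: "(\<lambda>t. 2 * mean_sq_dist (post i t) (post k t) + 2 * mean_sq_dist (post k t) (post l t)) \<longlonglongrightarrow> 0" by simp
    show ?case
    proof (rule tendsto_sandwich[OF _ _ tendsto_const lim])
      show "\<forall>\<^sub>F t in sequentially. 0 \<le> mean_sq_dist (post i t) (post l t)" by (simp add: mean_sq_dist_nonneg)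
      show "\<forall>\<^sub>F t in sequentially. mean_sq_dist (post i t) (post l t)
          \<le> 2 * mean_sq_dist (post i t) (post k t) + 2 * mean_sq_dist (post k t) (post l t)"
        by (intro always_eventually allI mean_sq_dist_triangle unit_bounded_post i kV lV)
    qed
  qed
qed

text \<open>The residual \<open>bayes - post i t\<close> is orthogonal to \<open>post i t\<close>, so only its product with \<open>bayes\<close>
  remains, and \<open>bayes\<close> is affine in the signals.  Testing against the signal of agent \<open>k\<close>,
  the state may be replaced by the posterior mean of \<open>k\<close>.\<close>
lemma mean_sq_dist_bayes_post:
  assumes i: "i \<in> pverts G" and t: "1 \<le> t"
  shows "mean_sq_dist bayes (post i t) \<le> (\<Sum>k\<in>pverts G. sqrt (mean_sq_dist (post k t) (post i t))) / (real n + 2)"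
proof -
  let ?s = "\<lambda>k \<omega>. of_bool (S k \<omega>) :: real"
  note ub = unit_bounded_bayes unit_bounded_post[OF i] unit_bounded_state
  have one: "unit_bounded (\<lambda>_. 1)" by (rule unit_boundedI) auto
  have s: "unit_bounded (?s k)" if "k \<in> pverts G" for k
    by (rule unit_bounded_of_bool[OF S_measurable[OF that]])
  have bayes_public: "bayes \<in> borel_measurable (public t)"
    by (rule measurable_from_subalg[OF subalgebra_public_signals bayes_signals_measurable])
  have split: "inner_L2 f bayes = (inner_L2 f (\<lambda>_. 1) + (\<Sum>k\<in>pverts G. inner_L2 f (?s k))) / (real n + 2)"
    if f: "unit_bounded f" for f
  proof -
    have "inner_L2 f bayes = expectation (\<lambda>\<omega>. (f \<omega> * 1 + (\<Sum>k\<in>pverts G. f \<omega> * ?s k \<omega>)) / (real n + 2))"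
      unfolding inner_L2_def bayes_def by (simp only: times_divide_eq_right distrib_left sum_distrib_left)
    also have "\<dots> = (expectation (\<lambda>\<omega>. f \<omega> * 1) + expectation (\<lambda>\<omega>. \<Sum>k\<in>pverts G. f \<omega> * ?s k \<omega>)) / (real n + 2)"
    proof -
      have "integrable M (\<lambda>\<omega>. \<Sum>k\<in>pverts G. f \<omega> * ?s k \<omega>)"
        by (intro Bochner_Integration.integrable_sum unit_bounded_integrable_mult[OF f s])
      with unit_bounded_integrable_mult[OF f one] show ?thesis
        by (simp only: integral_divide_zero Bochner_Integration.integral_add)
    qed
    also have "expectation (\<lambda>\<omega>. \<Sum>k\<in>pverts G. f \<omega> * ?s k \<omega>) = (\<Sum>k\<in>pverts G. inner_L2 f (?s k))"
      unfolding inner_L2_def by (rule Bochner_Integration.integral_sum) (rule unit_bounded_integrable_mult[OF f s])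
    finally show ?thesis by (simp add: inner_L2_def)
  qed
  have "inner_L2 (post i t) bayes = inner_L2 (post i t) (post i t)"
    using inner_state_bayes[OF t ub(2) post_public_measurable[OF i]]
      inner_state_post[OF i ub(2) post_info_measurable] by simp
  then have "mean_sq_dist bayes (post i t) = inner_L2 bayes bayes - inner_L2 (post i t) bayes"
    using mean_sq_dist_expand[OF ub(1) ub(2), of t] inner_L2_commute[of bayes "post i t"] by simp
  also have "inner_L2 bayes bayes = inner_L2 \<theta> bayes"
    using inner_state_bayes[OF t ub(1) bayes_public] by (simp add: inner_L2_commute)
  also have "inner_L2 \<theta> bayes - inner_L2 (post i t) bayes
      = (\<Sum>k\<in>pverts G. inner_L2 \<theta> (?s k) - inner_L2 (post i t) (?s k)) / (real n + 2)"
    unfolding split[OF ub(3)] split[OF ub(2)]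
    using inner_state_post[OF i one, of t]
    by (simp add: inner_L2_commute[of _ "\<lambda>_. 1"] diff_divide_distrib[symmetric] sum_subtractf)
  also have "\<dots> \<le> (\<Sum>k\<in>pverts G. sqrt (mean_sq_dist (post k t) (post i t))) / (real n + 2)"
  proof (intro divide_right_mono sum_mono)
    fix k assume k: "k \<in> pverts G"
    have "?s k \<in> borel_measurable (info M G S X k t)"
      using measurable_compose[OF S_info_measurable, of "of_bool :: bool \<Rightarrow> real" borel] by simp
    then have "inner_L2 \<theta> (?s k) = inner_L2 (post k t) (?s k)"
      using inner_state_post[OF k s[OF k]] by (simp add: inner_L2_commute)
    then show "inner_L2 \<theta> (?s k) - inner_L2 (post i t) (?s k) \<le> sqrt (mean_sq_dist (post k t) (post i t))"
      using inner_L2_diff_le[OF unit_bounded_post[OF k] ub(2) s[OF k], of t t] by linarith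
  qed simp
  finally show ?thesis .
qed

lemma mean_sq_dist_bayes_post_tendsto:
  assumes conn: "Digraph_Component.connected (with_proj G)" and i: "i \<in> pverts G"
  shows "(\<lambda>t. mean_sq_dist bayes (post i t)) \<longlonglongrightarrow> 0"
proof (rule tendsto_sandwich[OF _ _ tendsto_const])
  let ?b = "\<lambda>t. (\<Sum>k\<in>pverts G. sqrt (mean_sq_dist (post k t) (post i t))) / (real n + 2)"
  show "\<forall>\<^sub>F t in sequentially. 0 \<le> mean_sq_dist bayes (post i t)" by (simp add: mean_sq_dist_nonneg)
  show "\<forall>\<^sub>F t in sequentially. mean_sq_dist bayes (post i t) \<le> ?b t"
    using eventually_ge_at_top[of 1] by eventually_elim (rule mean_sq_dist_bayes_post[OF i])
  have "?b \<longlonglongrightarrow> (\<Sum>k\<in>pverts G. sqrt 0) / (real n + 2)"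
    by (intro tendsto_divide tendsto_sum tendsto_real_sqrt agents_agree[OF conn _ i] tendsto_const) auto
  then show "?b \<longlonglongrightarrow> 0" by simp
qed

lemma post_L1_tendsto:
  assumes conn: "Digraph_Component.connected (with_proj G)" and i: "i \<in> pverts G"
  shows "(\<lambda>t. expectation (\<lambda>\<omega>. \<bar>bayes \<omega> - post i t \<omega>\<bar>)) \<longlonglongrightarrow> 0"
proof (rule tendsto_sandwich[OF _ _ tendsto_const])
  show "(\<lambda>t. sqrt (mean_sq_dist bayes (post i t))) \<longlonglongrightarrow> 0"
    using tendsto_real_sqrt[OF mean_sq_dist_bayes_post_tendsto[OF conn i]] by simp
qed (auto intro!: always_eventually expectation_abs_diff_le unit_bounded_bayes unit_bounded_post i)

lemma post_AE_tendsto: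
  assumes conn: "Digraph_Component.connected (with_proj G)" and i: "i \<in> pverts G"
  shows "AE \<omega> in M. (\<lambda>t. post i t \<omega>) \<longlonglongrightarrow> bayes \<omega>"
proof -
  \<comment> \<open>Time starts at 1; hence the shift.\<close>
  let ?F = "\<lambda>t. info M G S X i (Suc t)"
  have eq: "AE \<omega> in M. real_cond_exp M (?F t) bayes \<omega> = post i (Suc t) \<omega>" for t
    by (rule real_cond_exp_info_bayes[OF i]) simp
  have [measurable]: "post i t \<in> borel_measurable M" for t
    by (rule unit_bounded_measurable[OF unit_bounded_post[OF i]])
  have "AE \<omega> in M. (\<lambda>t. real_cond_exp M (?F t) bayes \<omega>) \<longlonglongrightarrow> bayes \<omega>"
  proof (rule AE_tendsto_real_cond_exp[OF subalgebra_info[OF i] _ integrable_bayes])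
    have "expectation (\<lambda>\<omega>. \<bar>bayes \<omega> - real_cond_exp M (?F t) bayes \<omega>\<bar>)
        = expectation (\<lambda>\<omega>. \<bar>bayes \<omega> - post i (Suc t) \<omega>\<bar>)" for t
      by (rule integral_cong_AE) (use eq[of t] in auto)
    then show "(\<lambda>t. expectation (\<lambda>\<omega>. \<bar>bayes \<omega> - real_cond_exp M (?F t) bayes \<omega>\<bar>)) \<longlonglongrightarrow> 0"
      using LIMSEQ_Suc[OF post_L1_tendsto[OF conn i]] by simp
  qed (auto intro: info_mono[THEN subsetD, rotated])
  moreover have "AE \<omega> in M. \<forall>t. real_cond_exp M (?F t) bayes \<omega> = post i (Suc t) \<omega>"
    by (simp add: AE_all_countable eq)
  ultimately show ?thesis
  proof eventually_elim
    case (elim \<omega>)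
    then have "(\<lambda>t. post i (Suc t) \<omega>) \<longlonglongrightarrow> bayes \<omega>" by simp
    then show ?case by (rule LIMSEQ_imp_Suc)
  qed
qed

end

theorem theorem2p9:
  fixes M :: "'a measure" and n :: nat and G :: "nat pair_pre_digraph"
    and \<theta> :: "'a \<Rightarrow> real" and S :: "nat \<Rightarrow> 'a \<Rightarrow> bool"
    and \<nu> :: "nat \<Rightarrow> nat \<Rightarrow> 'a \<Rightarrow> real measure"
    and Y :: "nat \<Rightarrow> nat \<Rightarrow> 'a \<Rightarrow> real" and X :: "nat \<Rightarrow> nat \<Rightarrow> 'a \<Rightarrow> bool"
  assumes "bernoulli_sampling M n G \<theta> S \<nu> Y X"
    and "Digraph_Component.connected (with_proj G)"
  shows "\<exists>m_inf :: nat \<Rightarrow> 'a \<Rightarrow> real.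
    (\<forall>i\<in>pverts G.
       integrable M (m_inf i) \<and>
       (AE \<omega> in M. (\<lambda>t. post_mean M G \<theta> S X i t \<omega>) \<longlonglongrightarrow> m_inf i \<omega>) \<and>
       (\<lambda>t. \<integral>\<^sup>+ \<omega>. ennreal \<bar>post_mean M G \<theta> S X i t \<omega> - m_inf i \<omega>\<bar> \<partial>M) \<longlonglongrightarrow> 0) \<and>
    (AE \<omega> in M. \<forall>i\<in>pverts G. m_inf i \<omega> = real_cond_exp M (all_signals M G S) \<theta> \<omega>)"
proof -
  interpret bernoulli_sampling M n G \<theta> S \<nu> Y X by fact
  have "(\<lambda>t. \<integral>\<^sup>+ \<omega>. ennreal \<bar>post i t \<omega> - bayes \<omega>\<bar> \<partial>M) \<longlonglongrightarrow> 0" if i: "i \<in> pverts G" for i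
  proof -
    have "(\<integral>\<^sup>+ \<omega>. ennreal \<bar>post i t \<omega> - bayes \<omega>\<bar> \<partial>M) = ennreal (expectation (\<lambda>\<omega>. \<bar>bayes \<omega> - post i t \<omega>\<bar>))" for t
      using unit_bounded_integrable[OF unit_bounded_post[OF i, of t]] integrable_bayes
      by (subst nn_integral_eq_integral) (auto simp: abs_minus_commute)
    then show ?thesis
      using tendsto_ennrealI[OF post_L1_tendsto[OF assms(2) i]] by simp
  qed
  moreover have "AE \<omega> in M. \<forall>i\<in>pverts G. bayes \<omega> = real_cond_exp M (all_signals M G S) \<theta> \<omega>"
    using real_cond_exp_signals by eventually_elim simp
  ultimately show ?thesis
    using post_AE_tendsto[OF assms(2)] integrable_bayes by (intro exI[of _ "\<lambda>_. bayes"]) auto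
qed

end
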